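(* For each Banach space $X$ and each ordinal $0\leqslant \xi<\omega_1$, there exists a topology $\tau_\xi$ on $X$ such that the $\xi$-weakly compact subsets of $X$ are exactly the compact subsets of $X$ in the $\tau_\xi$ topology, and the $\xi$-weakly precompact subsets of $X$ are exactly the relatively compact subsets of $X$ in the $\tau_\xi$ topology.
   Context: Banach spaces are over $\mathbb{K}\in\{\mathbb{R},\mathbb{C}\}$; $\mathbb{N}=\{1,2,\ldots\}$; $\omega_1$ is the first uncountable ordinal. For subsets $E,F$ of $\mathbb{N}$, $E<F$ means $\max E<\min F$ (with $\max\varnothing=0$, $\min\varnothing=\infty$), and $n\leqslant E$ means $n\leqslant\min E$. Schreier families $\mathcal{S}_\xi$ ($\xi<\omega_1$), families of finite subsets of $\mathbb{N}$: $\mathcal{S}_0=\{\varnothing\}\cup\{\{n\}:n\in\mathbb{N}\}$; $\mathcal{S}_{\xi+1}=\{\varnothing\}\cup\{\bigcup_{i=1}^nE_i: \varnothing\neq E_i\in\mathcal{S}_\xi,\ E_1<\ldots<E_n,\ n\leqslant\min E_1\}$; and for $\xi$ a limit ordinal, one fixes a sequence of ordinals $\xi_n\uparrow\xi$ and sets $\mathcal{S}_\xi=\{E: \exists n\in\mathbb{N},\ n\leqslant E\in\mathcal{S}_{\xi_n}\}$. For $0<\xi<\omega_1$, a sequence $(x_n)_{n=1}^\infty$ in a Banach space is an $\ell_1^\xi$-spreading model if $0<\inf\{\|x\|: E\in\mathcal{S}_\xi,\ x=\sum_{n\in E}a_nx_n,\ \sum_{n\in E}|a_n|=1\}$. For $0<\xi<\omega_1$,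 $(x_n)_{n=1}^\infty\subset X$ is $\xi$-weakly convergent to $x\in X$ if it converges weakly to $x$ and no subsequence of $(x_n-x)_{n=1}^\infty$ is an $\ell_1^\xi$-spreading model. $0$-weakly convergent means norm convergent. A subset $K$ of a Banach space $X$ is $\xi$-weakly precompact (resp. $\xi$-weakly compact) if every sequence in $K$ has a subsequence which is $\xi$-weakly convergent to some member of $X$ (resp. of $K$). A set is relatively compact in a topology if its closure in that topology is compact. *)

theory Defs
  imports "HOL-Analysis.Analysis" "HOL-Library.Countable_Set_Type"
begin

section \<open>Banach spaces over the real or complex field\<close>

text \<open>
  Up to isometric isomorphism, the instances of this class are exactly \<open>\<real>\<close> and \<open>\<complex>\<close>
  with their usual absolute values.
\<close>

class real_or_complex = real_normed_field +
  assumes real_or_complex: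
    "(\<forall>z. \<exists>a. z = a *\<^sub>R 1) \<or>
     (\<exists>i. i * i = - 1 \<and> (\<forall>z. \<exists>a b. z = a *\<^sub>R 1 + b *\<^sub>R i) \<and>
          (\<forall>a b. norm (a *\<^sub>R 1 + b *\<^sub>R i) = sqrt (a\<^sup>2 + b\<^sup>2)))"

instance real :: real_or_complex
  by standard simp

instance complex :: real_or_complex
proof (standard, rule disjI2, rule exI[of _ \<i>], intro conjI allI)
  show "\<exists>a b. z = a *\<^sub>R 1 + b *\<^sub>R \<i>" for z :: complex
    by (rule exI[of _ "Re z"], rule exI[of _ "Im z"]) (simp add: complex_eq_iff)
  show "norm (a *\<^sub>R 1 + b *\<^sub>R \<i>) = sqrt (a\<^sup>2 + b\<^sup>2)" for a b
    by (simp add: cmod_def)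
qed simp

text \<open>
  A Banach space over \<open>'k\<close> is a real Banach space (class \<^class>\<open>banach\<close>) with a scalar
  multiplication by \<open>'k\<close> that extends the real one and for which the norm is homogeneous.
  If \<open>'k\<close> is \<^typ>\<open>real\<close>, the scalar multiplication is necessarily \<^const>\<open>scaleR\<close>.
\<close>

locale banach_space_over = vector_space smul
  for smul :: "'k::real_or_complex \<Rightarrow> 'a::banach \<Rightarrow> 'a" +
  assumes smul_of_real: "smul (of_real r) x = r *\<^sub>R x"
    and norm_smul: "norm (smul c x) = norm c * norm x"

lemma banach_space_over_scaleR: "banach_space_over ((*\<^sub>R) :: real \<Rightarrow> 'a::banach \<Rightarrow> 'a)"
  by standard (simp_all add: algebra_simps)

lemma banach_space_over_complex: "banach_space_over ((*) :: complex \<Rightarrow> complex \<Rightarrow> complex)"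
  by standard (simp_all add: algebra_simps norm_mult scaleR_conv_of_real)


section \<open>Countable ordinals\<close>

text \<open>
  The elements of this type are the ordinals below \<open>\<omega>\<^sub>1\<close>: \<^term>\<open>cardSuc natLeq\<close> is a
  well-order of the least uncountable order type.
\<close>

typedef omega1 = "Field (cardSuc natLeq)"
  using Field_cardSuc_not_empty[OF natLeq_Card_order] by auto

instantiation omega1 :: linorder
begin

definition less_eq_omega1 :: "omega1 \<Rightarrow> omega1 \<Rightarrow> bool" where
  "\<xi> \<le> \<eta> \<longleftrightarrow> (Rep_omega1 \<xi>, Rep_omega1 \<eta>) \<in> cardSuc natLeq"

definition less_omega1 :: "omega1 \<Rightarrow> omega1 \<Rightarrow> bool" where
  "\<xi> < (\<eta> :: omega1) \<longleftrightarrow> \<xi> \<le> \<eta> \<and> \<xi> \<noteq> \<eta>"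

instance
proof -
  have wo: "Well_order (cardSuc natLeq)"
    by (rule cardSuc_Well_order[OF natLeq_Card_order])
  have lin: "refl_on (Field (cardSuc natLeq)) (cardSuc natLeq)" "trans (cardSuc natLeq)"
    "antisym (cardSuc natLeq)" "total_on (Field (cardSuc natLeq)) (cardSuc natLeq)"
    using wo unfolding well_order_on_def linear_order_on_def partial_order_on_def preorder_on_def
    by auto
  show "OFCLASS(omega1, linorder_class)"
  proof
    fix \<xi> \<eta> \<zeta> :: omega1
    show le_refl: "\<xi> \<le> \<xi>"
      unfolding less_eq_omega1_def by (rule refl_onD[OF lin(1) Rep_omega1])
    show "\<xi> \<le> \<eta> \<Longrightarrow> \<eta> \<le> \<zeta> \<Longrightarrow> \<xi> \<le> \<zeta>"
      unfolding less_eq_omega1_def by (rule transD[OF lin(2)])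
    show antisym: "\<xi> \<le> \<eta> \<Longrightarrow> \<eta> \<le> \<xi> \<Longrightarrow> \<xi> = \<eta>"
      unfolding less_eq_omega1_def using antisymD[OF lin(3)] Rep_omega1_inject by metis
    show "(\<xi> < \<eta>) = (\<xi> \<le> \<eta> \<and> \<not> \<eta> \<le> \<xi>)"
      unfolding less_omega1_def using le_refl antisym by auto
    show "\<xi> \<le> \<eta> \<or> \<eta> \<le> \<xi>"
      using le_refl lin(4) Rep_omega1[of \<xi>] Rep_omega1[of \<eta>]
      unfolding less_eq_omega1_def total_on_def by (metis Rep_omega1_inject)
  qed
qed

end

instance omega1 :: wellorder
proof
  fix P :: "omega1 \<Rightarrow> bool" and \<xi>
  assume step: "\<And>\<xi>. (\<And>\<eta>. \<eta> < \<xi> \<Longrightarrow> P \<eta>) \<Longrightarrow> P \<xi>"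
  have "wf (cardSuc natLeq - Id)"
    using cardSuc_Well_order[OF natLeq_Card_order] unfolding well_order_on_def by auto
  then have "wf (inv_image (cardSuc natLeq - Id) Rep_omega1)"
    by (rule wf_inv_image)
  moreover have "{(\<eta>, \<xi>). \<eta> < \<xi>} \<subseteq> inv_image (cardSuc natLeq - Id) Rep_omega1"
    by (auto simp: less_omega1_def less_eq_omega1_def Rep_omega1_inject)
  ultimately have "wf {(\<eta>, \<xi> :: omega1). \<eta> < \<xi>}"
    by (rule wf_subset)
  then show "P \<xi>"
    by (rule wf_induct_rule) (use step in auto)
qed

lemma countable_lessThan_omega1:
  includes cardinal_syntax
  shows "countable {..<\<xi> :: omega1}"
proof -
  have "|underS (cardSuc natLeq) (Rep_omega1 \<xi>)| <o cardSuc natLeq"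
    by (rule card_of_underS[OF cardSuc_Card_order[OF natLeq_Card_order] Rep_omega1])
  then have "|underS (cardSuc natLeq) (Rep_omega1 \<xi>)| \<le>o natLeq"
    using cardSuc_ordLeq_ordLess[OF natLeq_Card_order card_of_Card_order] by blast
  then have "countable (underS (cardSuc natLeq) (Rep_omega1 \<xi>))"
    by (simp add: countable_card_le_natLeq)
  moreover have "Rep_omega1 ` {..<\<xi>} \<subseteq> underS (cardSuc natLeq) (Rep_omega1 \<xi>)"
    by (auto simp: underS_def less_omega1_def less_eq_omega1_def Rep_omega1_inject)
  ultimately have "countable (Rep_omega1 ` {..<\<xi>})"
    using countable_subset by blast
  then show ?thesis
    by (rule countable_image_inj_on) (simp add: inj_on_def Rep_omega1_inject)
qed

lemma uncountable_omega1:
  includes cardinal_syntax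
  shows "uncountable (UNIV :: omega1 set)"
proof
  assume "countable (UNIV :: omega1 set)"
  then have "countable (range Rep_omega1)"
    by (rule countable_image)
  then have "countable (Field (cardSuc natLeq))"
    by (simp add: type_definition.Rep_range[OF type_definition_omega1])
  then have "|Field (cardSuc natLeq)| \<le>o natLeq"
    by (simp add: countable_card_le_natLeq)
  then have "cardSuc natLeq \<le>o natLeq"
    using card_of_Field_ordIso[OF cardSuc_Card_order[OF natLeq_Card_order]]
      ordIso_ordLeq_trans ordIso_symmetric by blast
  then show False
    using cardSuc_greater[OF natLeq_Card_order] not_ordLess_ordLeq by blast
qed

instantiation omega1 :: zero
begin

definition zero_omega1 :: omega1 where
  "(0 :: omega1) = (LEAST \<xi>. True)"

instance ..

end

definition osuc :: "omega1 \<Rightarrow> omega1" where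
  "osuc \<xi> = (LEAST \<eta>. \<xi> < \<eta>)"

lemma less_osuc: "\<xi> < osuc \<xi>"
proof -
  have "\<exists>\<eta>. \<xi> < \<eta>"
  proof (rule ccontr)
    assume "\<nexists>\<eta>. \<xi> < \<eta>"
    then have "(UNIV :: omega1 set) = insert \<xi> {..<\<xi>}"
      by (auto simp: not_less intro: order.not_eq_order_implies_strict)
    then show False
      using uncountable_omega1 countable_lessThan_omega1[of \<xi>] by (metis countable_insert)
  qed
  then show ?thesis
    unfolding osuc_def by (rule LeastI_ex)
qed

definition is_limit :: "omega1 \<Rightarrow> bool" where
  "is_limit \<xi> \<longleftrightarrow> \<xi> \<noteq> 0 \<and> (\<forall>\<eta>. \<xi> \<noteq> osuc \<eta>)"


section \<open>Schreier families\<close>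

text \<open>
  The choice of sequences \<open>\<xi>\<^sub>n \<up> \<xi>\<close> for the limit ordinals \<open>\<xi>\<close> is a parameter: \<open>L \<xi> n\<close> is
  \<open>\<xi>\<^sub>n\<close>. Here and below sequences are indexed by \<open>{1, 2, \<dots>}\<close>; their values at \<open>0\<close> are
  never used.
\<close>

definition ladder_system :: "(omega1 \<Rightarrow> nat \<Rightarrow> omega1) \<Rightarrow> bool" where
  "ladder_system L \<longleftrightarrow>
     (\<forall>\<xi>. is_limit \<xi> \<longrightarrow>
        (\<forall>n\<ge>1. L \<xi> n < \<xi> \<and> L \<xi> n \<le> L \<xi> (Suc n)) \<and>
        (\<forall>\<eta><\<xi>. \<exists>n\<ge>1. \<eta> < L \<xi> n))"

lemma ladder_system_exists: "\<exists>L. ladder_system L"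
proof
  define e where "e \<xi> = from_nat_into {..<\<xi>}" for \<xi> :: omega1
  define L where "L \<xi> n = Max (e \<xi> ` {..n})" for \<xi> n
  show "ladder_system L"
    unfolding ladder_system_def
  proof (intro allI impI conjI)
    fix \<xi> assume lim: "is_limit \<xi>"
    have least: "0 \<le> \<eta>" for \<eta> :: omega1
      unfolding zero_omega1_def by (simp add: Least_le)
    have "0 < \<xi>"
      using lim least[of \<xi>] by (auto simp: is_limit_def order_less_le)
    then have ne: "{..<\<xi>} \<noteq> {}"
      by auto
    have e: "e \<xi> n < \<xi>" for n
      using from_nat_into[OF ne] by (auto simp: e_def)
    show "L \<xi> n < \<xi>" for n
      by (auto simp: L_def e)
    show "L \<xi> n \<le> L \<xi> (Suc n)" for n
      unfolding L_def by (rule Max_mono) auto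
    fix \<eta> assume "\<eta> < \<xi>"
    then have "osuc \<eta> < \<xi>"
      using lim Least_le[of "\<lambda>\<zeta>. \<eta> < \<zeta>" \<xi>] by (auto simp: is_limit_def osuc_def order_less_le)
    then obtain n where n: "e \<xi> n = osuc \<eta>"
      unfolding e_def using from_nat_into_surj[OF countable_lessThan_omega1] by blast
    have "\<eta> < e \<xi> n"
      by (simp add: n less_osuc)
    also have "e \<xi> n \<le> L \<xi> (Suc n)"
      unfolding L_def by (rule Max_ge) auto
    finally show "\<exists>n\<ge>1. \<eta> < L \<xi> n"
      by (intro exI[of _ "Suc n"]) auto
  qed
qed

text \<open>The least fixed point is given by transfinite recursion, as \<open>L \<xi> n < \<xi>\<close> at limits.\<close>

inductive schreier :: "(omega1 \<Rightarrow> nat \<Rightarrow> omega1) \<Rightarrow> omega1 \<Rightarrow> nat set \<Rightarrow> bool"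
  for L where
  zero_empty: "schreier L 0 {}"
| zero_singleton: "n \<ge> 1 \<Longrightarrow> schreier L 0 {n}"
| succ_empty: "schreier L (osuc \<xi>) {}"
| succ_Union: "\<lbrakk>n \<ge> 1; \<forall>i\<in>{1..n}. E i \<noteq> {} \<and> schreier L \<xi> (E i);
     \<forall>i\<in>{1..<n}. \<forall>k\<in>E i. \<forall>m\<in>E (Suc i). k < m; \<forall>m\<in>E 1. n \<le> m\<rbrakk>
   \<Longrightarrow> schreier L (osuc \<xi>) (\<Union>i\<in>{1..n}. E i)"
| limit: "\<lbrakk>is_limit \<xi>; n \<ge> 1; \<forall>m\<in>E. n \<le> m; schreier L (L \<xi> n) E\<rbrakk> \<Longrightarrow> schreier L \<xi> E"


section \<open>Weak convergence and weak compactness of order \<open>\<xi>\<close>\<close>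

definition weakly_convergent_to ::
    "('k::real_or_complex \<Rightarrow> 'a::banach \<Rightarrow> 'a) \<Rightarrow> (nat \<Rightarrow> 'a) \<Rightarrow> 'a \<Rightarrow> bool" where
  "weakly_convergent_to smul x l \<longleftrightarrow>
     (\<forall>f. Vector_Spaces.linear smul (*) f \<and> continuous_on UNIV f \<longrightarrow>
          (\<lambda>n. f (x n)) \<longlonglongrightarrow> f l)"

definition ell1_spreading_model ::
    "('k::real_or_complex \<Rightarrow> 'a::banach \<Rightarrow> 'a) \<Rightarrow> (omega1 \<Rightarrow> nat \<Rightarrow> omega1) \<Rightarrow> omega1 \<Rightarrow>
     (nat \<Rightarrow> 'a) \<Rightarrow> bool" where
  "ell1_spreading_model smul L \<xi> x \<longleftrightarrow>
     0 < Inf {norm (\<Sum>n\<in>E. smul (a n) (x n)) | E a. schreier L \<xi> E \<and> (\<Sum>n\<in>E. norm (a n)) = 1}"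

text \<open>
  Any strictly increasing map from \<open>{1, 2, \<dots>}\<close> to itself extends by \<open>0 \<mapsto> 0\<close> to a
  strictly increasing \<open>r :: nat \<Rightarrow> nat\<close>, and any such \<open>r\<close> restricts to \<open>{1, 2, \<dots>}\<close>.
\<close>

definition ord_weakly_convergent_to ::
    "('k::real_or_complex \<Rightarrow> 'a::banach \<Rightarrow> 'a) \<Rightarrow> (omega1 \<Rightarrow> nat \<Rightarrow> omega1) \<Rightarrow> omega1 \<Rightarrow>
     (nat \<Rightarrow> 'a) \<Rightarrow> 'a \<Rightarrow> bool" where
  "ord_weakly_convergent_to smul L \<xi> x l \<longleftrightarrow>
     (if \<xi> = 0 then x \<longlonglongrightarrow> l
      else weakly_convergent_to smul x l \<and>
           (\<nexists>r. strict_mono r \<and> ell1_spreading_model smul L \<xi> (\<lambda>n. x (r n) - l)))"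

definition ord_weakly_precompact ::
    "('k::real_or_complex \<Rightarrow> 'a::banach \<Rightarrow> 'a) \<Rightarrow> (omega1 \<Rightarrow> nat \<Rightarrow> omega1) \<Rightarrow> omega1 \<Rightarrow>
     'a set \<Rightarrow> bool" where
  "ord_weakly_precompact smul L \<xi> K \<longleftrightarrow>
     (\<forall>x :: nat \<Rightarrow> 'a. (\<forall>n\<ge>1. x n \<in> K) \<longrightarrow>
        (\<exists>l r. strict_mono r \<and> ord_weakly_convergent_to smul L \<xi> (x \<circ> r) l))"

definition ord_weakly_compact ::
    "('k::real_or_complex \<Rightarrow> 'a::banach \<Rightarrow> 'a) \<Rightarrow> (omega1 \<Rightarrow> nat \<Rightarrow> omega1) \<Rightarrow> omega1 \<Rightarrow>
     'a set \<Rightarrow> bool" where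
  "ord_weakly_compact smul L \<xi> K \<longleftrightarrow>
     (\<forall>x :: nat \<Rightarrow> 'a. (\<forall>n\<ge>1. x n \<in> K) \<longrightarrow>
        (\<exists>l\<in>K. \<exists>r. strict_mono r \<and> ord_weakly_convergent_to smul L \<xi> (x \<circ> r) l))"

end

theory Submission
  imports Defs
begin

text \<open>
  The topology is the finest one in which every sequence that converges weakly of order \<open>\<xi>\<close>
  converges to its limit: a set is closed iff it contains the limits of the \<open>\<xi>\<close>-weakly convergent
  sequences in it. The \<open>\<xi>\<close>-weakly compact sets are the sequentially compact ones, and the task is to
  compare sequential compactness with compactness.

  \<^bold>\<open>Compact sets.\<close> If a sequence in a compact set had no \<open>\<xi>\<close>-weakly convergent subsequence with limit in the
  set, its tails would give closed sets that contradict compactness (\<open>compactin_imp_seq_compact_for\<close>).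
  Conversely, let \<open>K\<close> be \<open>\<xi>\<close>-weakly compact and let closed sets have the finite intersection
  property on \<open>K\<close>. An ultrafilter refining them has a limit in the bidual. Whitley's proof of the
  Eberlein--Smulian theorem, carried out inside each of the closed sets, shows that this limit is a
  point of each of them (\<open>ultrafilter_limit_attained\<close>).

  \<^bold>\<open>Precompact sets.\<close> Here one has to show that the set of all limits of sequences from a
  \<open>\<xi>\<close>-weakly precompact set \<open>K\<close> is \<open>\<xi>\<close>-weakly compact. That a sequence of such limits has a weakly
  convergent subsequence is a diagonal argument with countably many separating functionals
  (\<open>seq_closure_weak_subseq\<close>). The heart of the matter is that weak convergence can be improved to
  order \<open>\<xi>\<close>. Suppose \<open>v n = y n - l\<close> is weakly null and an \<open>\<ell>\<^sub>1\<close> spreading model of order \<open>\<xi>\<close>, and that \<open>v n\<close> is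
  the weak limit of \<open>w n k\<close> as \<open>k \<rightarrow> \<infinity>\<close>. One needs \<open>k\<close> depending on \<open>n\<close> such that, for \<open>n\<close> in some infinite set,
  the points \<open>w n k\<close> again form a spreading model. For a single Schreier set \<open>E\<close> large \<open>k\<close> are good, but
  how large depends on all of \<open>E\<close>, whereas \<open>k\<close> has to be chosen before the later elements of \<open>E\<close> are known.
  This is overcome by a tree of functionals of norm at most one, indexed by subsets \<open>F\<close> of Schreier sets: the functional of
  \<open>F\<close> takes a fixed value \<open>c > 0\<close> at \<open>v n\<close> for \<open>n \<in> F\<close>, and it is the pointwise limit, along a free
  ultrafilter, of the functionals of the sets \<open>insert n F\<close>, provided that almost all \<open>n\<close> yield such a set
  (\<open>functional_tree\<close>). Since the functionals of later sets converge to earlier ones, an inductive choice of points has to satisfy only finitely many conditions at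
  each step (\<open>diagonal_selection_step\<close>). The resulting functionals are approximately \<open>c\<close> on \<open>F\<close>
  and \<open>0\<close> at the other points for every \<open>F\<close>, and this gives \<open>\<ell>\<^sub>1\<close> estimates for arbitrary coefficients
  (\<open>ell1_lower_estimate\<close>).

  The functionals are real-linear and are supplied by the Hahn--Banach theorem for sublinear functionals.
\<close>


section \<open>The Hahn--Banach theorem for sublinear functionals\<close>

definition sublinear :: "('a::real_vector \<Rightarrow> real) \<Rightarrow> bool" where
  "sublinear p \<longleftrightarrow> (\<forall>x y. p (x + y) \<le> p x + p y) \<and> (\<forall>t x. 0 \<le> t \<longrightarrow> p (t *\<^sub>R x) = t * p x)"

lemma sublinearD:
  assumes "sublinear p"
  shows "p (x + y) \<le> p x + p y" "0 \<le> t \<Longrightarrow> p (t *\<^sub>R x) = t * p x" "p 0 = 0" "- p (- x) \<le> p x"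
proof -
  show 1: "p (x + y) \<le> p x + p y" for x y
    using assms by (auto simp: sublinear_def)
  show "0 \<le> t \<Longrightarrow> p (t *\<^sub>R x) = t * p x"
    using assms by (auto simp: sublinear_def)
  have "p (0 *\<^sub>R 0) = 0 * p 0"
    using assms unfolding sublinear_def by blast
  then show "p 0 = 0" by simp
  then show "- p (- x) \<le> p x"
    using 1[of x "- x"] by simp
qed

text \<open>
  The functional \<open>q x = inf (p (x + v) - r)\<close>, over \<open>(v, r) \<in> G\<close>, is finite because
  \<open>p (x + v) - r \<ge> p (x + v) - p v \<ge> - p (- x)\<close>. Its purpose is that a linear \<open>f \<le> q\<close> satisfies
  both \<open>f \<le> p\<close> and \<open>r \<le> f v\<close> on \<open>G\<close>: take \<open>x = - v\<close> in the conclusion.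
\<close>

lemma sublinear_cone_infimum:
  fixes p :: "'a::real_vector \<Rightarrow> real" and G :: "('a \<times> real) set"
  assumes p: "sublinear p"
    and zero: "(0, 0) \<in> G"
    and add: "\<And>v r w s. (v, r) \<in> G \<Longrightarrow> (w, s) \<in> G \<Longrightarrow> (v + w, r + s) \<in> G"
    and scale: "\<And>t v r. (v, r) \<in> G \<Longrightarrow> 0 \<le> t \<Longrightarrow> (t *\<^sub>R v, t * r) \<in> G"
    and below: "\<And>v r. (v, r) \<in> G \<Longrightarrow> r \<le> p v"
  obtains q where "sublinear q" "\<And>x v r. (v, r) \<in> G \<Longrightarrow> q x \<le> p (x + v) - r"
proof -
  define q where "q x = (INF g\<in>G. p (x + fst g) - snd g)" for x
  have lower: "- p (- x) \<le> p (x + fst g) - snd g" if "g \<in> G" for g x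
  proof -
    have "p (fst g) \<le> p (x + fst g) + p (- x)"
      using sublinearD(1)[OF p, of "x + fst g" "- x"] by simp
    moreover have "snd g \<le> p (fst g)"
      using below[of "fst g" "snd g"] that by simp
    ultimately show ?thesis by linarith
  qed
  have ne: "G \<noteq> {}" using zero by auto
  have q_le: "q x \<le> p (x + v) - r" if "(v, r) \<in> G" for x v r
  proof -
    have "bdd_below ((\<lambda>g. p (x + fst g) - snd g) ` G)"
      using lower by (intro bdd_belowI2[of _ "- p (- x)"]) auto
    from cINF_lower[OF this that] show ?thesis by (simp add: q_def)
  qed
  have q_ge: "m \<le> q x" if "\<And>v r. (v, r) \<in> G \<Longrightarrow> m \<le> p (x + v) - r" for m x
    unfolding q_def using that by (intro cINF_greatest[OF ne]) auto
  have "sublinear q"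
    unfolding sublinear_def
  proof (intro conjI allI impI)
    fix x y
    have "q (x + y) - (p (x + v) - r) \<le> q y" if g: "(v, r) \<in> G" for v r
    proof (rule q_ge)
      fix w s assume h: "(w, s) \<in> G"
      have "q (x + y) \<le> p ((x + y) + (v + w)) - (r + s)"
        by (rule q_le[OF add[OF g h]])
      also have "p ((x + y) + (v + w)) \<le> p (x + v) + p (y + w)"
        using sublinearD(1)[OF p, of "x + v" "y + w"] by (simp add: algebra_simps)
      finally show "q (x + y) - (p (x + v) - r) \<le> p (y + w) - s" by simp
    qed
    then have "q (x + y) - q y \<le> q x"
      by (intro q_ge) (smt (verit))
    then show "q (x + y) \<le> q x + q y" by simp
  next
    fix t :: real and x assume t: "0 \<le> t"
    have up: "q (t *\<^sub>R x) \<le> t * q x" if t: "0 < t" for t x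
    proof -
      have "q (t *\<^sub>R x) / t \<le> q x"
      proof (rule q_ge)
        fix v r assume "(v, r) \<in> G"
        then have "q (t *\<^sub>R x) \<le> p (t *\<^sub>R x + t *\<^sub>R v) - t * r"
          using t by (intro q_le scale) auto
        also have "\<dots> = t * (p (x + v) - r)"
          using t sublinearD(2)[OF p, of t "x + v"] by (simp add: algebra_simps)
        finally show "q (t *\<^sub>R x) / t \<le> p (x + v) - r"
          using t by (simp add: divide_le_eq mult.commute)
      qed
      then show ?thesis using t by (simp add: divide_le_eq mult.commute)
    qed
    show "q (t *\<^sub>R x) = t * q x"
    proof (cases "t = 0")
      case True
      have "q 0 \<le> 0" using q_le[OF zero, of 0] sublinearD(3)[OF p] by simp
      moreover have "0 \<le> q 0"
        using lower[of _ 0] sublinearD(3)[OF p] by (intro q_ge) auto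
      ultimately show ?thesis using True by simp
    next
      case False
      then have t: "0 < t" using t by simp
      have "q ((1/t) *\<^sub>R (t *\<^sub>R x)) \<le> (1/t) * q (t *\<^sub>R x)"
        using t by (intro up) auto
      then have "t * q x \<le> q (t *\<^sub>R x)"
        using t by (simp add: field_simps)
      then show ?thesis using up[OF t, of x] by simp
    qed
  qed
  with q_le show ?thesis by (rule that[rotated 1]) 
qed

lemma Chains_relation_of_dest:
  assumes "C \<in> Chains (relation_of P A)"
  shows "C \<subseteq> A" "a \<in> C \<Longrightarrow> b \<in> C \<Longrightarrow> P a b \<or> P b a"
  using assms unfolding Chains_def relation_of_def by auto

text \<open>
  Zorn's lemma applies since the pointwise infimum of a chain of sublinear functionals below \<open>p\<close> is
  finite, being at least \<open>- p (- x)\<close>, and is subadditive: two members of the chain can both be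
  replaced by the smaller one.
\<close>

lemma exists_minimal_sublinear:
  fixes p :: "'a::real_vector \<Rightarrow> real"
  assumes p: "sublinear p"
  obtains q where "sublinear q" "\<And>x. q x \<le> p x"
    "\<And>q'. sublinear q' \<Longrightarrow> (\<And>x. q' x \<le> q x) \<Longrightarrow> q' = q"
proof -
  define A where "A = {q. sublinear q \<and> (\<forall>x. q x \<le> p x)}"
  define P where "P q q' \<longleftrightarrow> (\<forall>x. q' x \<le> q x)" for q q' :: "'a \<Rightarrow> real"
  have "\<exists>m\<in>A. \<forall>a\<in>A. P m a \<longrightarrow> a = m"
  proof (rule predicate_Zorn)
    show "partial_order_on A (relation_of P A)"
      by (rule partial_order_on_relation_ofI) (auto simp: P_def fun_eq_iff intro: order_trans order_antisym)
  next
    fix C assume C: "C \<in> Chains (relation_of P A)"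
    note CA = Chains_relation_of_dest(1)[OF C] and chain = Chains_relation_of_dest(2)[OF C]
    show "\<exists>u\<in>A. \<forall>a\<in>C. P a u"
    proof (cases "C = {}")
      case True
      then show ?thesis using p by (auto simp: A_def)
    next
      case ne: False
      define u where "u x = (INF q\<in>C. q x)" for x
      have sub: "sublinear q" and le: "q x \<le> p x" if "q \<in> C" for q x
        using that CA by (auto simp: A_def)
      have lower: "- p (- x) \<le> q x" if "q \<in> C" for q x
        using sublinearD(4)[OF sub[OF that], of x] le[OF that, of "- x"] by linarith
      have u_le: "u x \<le> q x" if "q \<in> C" for q x
        unfolding u_def using that lower by (intro cINF_lower bdd_belowI2[of _ "- p (- x)"]) auto
      have u_ge: "m \<le> u x" if "\<And>q. q \<in> C \<Longrightarrow> m \<le> q x" for m x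
        unfolding u_def using that by (intro cINF_greatest[OF ne]) auto
      have "sublinear u"
        unfolding sublinear_def
      proof (intro conjI allI impI)
        fix x y
        have "u (x + y) \<le> q x + q' y" if "q \<in> C" "q' \<in> C" for q q'
          using chain[OF that] that u_le[of q "x + y"] u_le[of q' "x + y"]
            sublinearD(1)[OF sub, of q x y] sublinearD(1)[OF sub, of q' x y]
          unfolding P_def by (smt (verit))
        then have "u (x + y) - q x \<le> u y" if "q \<in> C" for q
          using that by (intro u_ge) (smt (verit))
        then have "u (x + y) - u y \<le> u x"
          by (intro u_ge) (smt (verit))
        then show "u (x + y) \<le> u x + u y" by simp
      next
        fix t :: real and x assume t: "0 \<le> t"
        show "u (t *\<^sub>R x) = t * u x"
        proof (rule antisym)
          obtain q0 where q0: "q0 \<in> C" using ne by auto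
          show "u (t *\<^sub>R x) \<le> t * u x"
          proof (cases "t = 0")
            case True
            then show ?thesis using u_le[OF q0, of 0] sublinearD(3)[OF sub[OF q0]] by simp
          next
            case False
            then have "u (t *\<^sub>R x) / t \<le> u x"
              using t u_le[of _ "t *\<^sub>R x"] sublinearD(2)[OF sub t]
              by (intro u_ge) (simp add: divide_le_eq mult.commute)
            then show ?thesis using t False by (simp add: divide_le_eq mult.commute)
          qed
          show "t * u x \<le> u (t *\<^sub>R x)"
            using sublinearD(2)[OF sub t] u_le[of _ x] t
            by (intro u_ge) (metis mult_left_mono)
        qed
      qed
      moreover have "u x \<le> p x" for x
        using ne u_le le by (meson all_not_in_conv order_trans)
      ultimately show ?thesis using u_le by (auto simp: A_def P_def)
    qed
  qed
  then obtain m where "m \<in> A" "\<And>a. a \<in> A \<Longrightarrow> P m a \<Longrightarrow> a = m" by blast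
  then show ?thesis
    by (intro that[of m]) (auto simp: A_def P_def intro: order_trans)
qed

text \<open>
  A minimal sublinear functional \<open>q\<close> is linear. For given \<open>y\<close>, pushing \<open>q\<close> down along the cone
  spanned by \<open>(y, q y)\<close> yields a sublinear \<open>q' \<le> q\<close> with \<open>q' (- y) \<le> - q y\<close>; by minimality
  \<open>q' = q\<close>, so \<open>q\<close> is odd, and an odd sublinear functional is additive.
\<close>

theorem hahn_banach:
  fixes p :: "'a::real_vector \<Rightarrow> real"
  assumes "sublinear p"
  obtains f where "linear f" "\<And>x. f x \<le> p x"
proof -
  obtain q where q: "sublinear q" and qp: "\<And>x. q x \<le> p x"
    and min: "\<And>q'. sublinear q' \<Longrightarrow> (\<And>x. q' x \<le> q x) \<Longrightarrow> q' = q"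
    using exists_minimal_sublinear[OF assms] by metis
  have neg: "q (- y) \<le> - q y" for y
  proof -
    define G where "G = {(t *\<^sub>R y, t * q y) |t. 0 \<le> t}"
    have G: "(t *\<^sub>R y, t * q y) \<in> G" if "0 \<le> t" for t
      using that by (auto simp: G_def)
    obtain q' where q': "sublinear q'" "\<And>x v r. (v, r) \<in> G \<Longrightarrow> q' x \<le> q (x + v) - r"
    proof (rule sublinear_cone_infimum[OF q, of G])
      show "(0, 0) \<in> G" using G[of 0] by simp
      show "(v + w, r + s) \<in> G" if "(v, r) \<in> G" "(w, s) \<in> G" for v r w s
        using that unfolding G_def by clarsimp (metis add_nonneg_nonneg distrib_right scaleR_left_distrib)
      show "(t *\<^sub>R v, t * r) \<in> G" if "(v, r) \<in> G" "0 \<le> t" for t v r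
        using that unfolding G_def by clarsimp (metis mult_nonneg_nonneg mult.assoc)
      show "r \<le> q v" if "(v, r) \<in> G" for v r
        using that sublinearD(2)[OF q] by (auto simp: G_def)
    qed (use that in blast)
    have "q' x \<le> q x" for x
      using q'(2)[OF G[of 0], of x] by simp
    then have "q' = q" by (rule min[OF q'(1)])
    then show ?thesis
      using q'(2)[OF G[of 1], of "- y"] sublinearD(3)[OF q] by simp
  qed
  then have neg: "q (- y) = - q y" for y
    using sublinearD(4)[OF q, of y] by (simp add: order_antisym neg minus_le_iff)
  have "linear q"
  proof (rule linearI)
    show "q (x + y) = q x + q y" for x y
      using sublinearD(1)[OF q, of x y] sublinearD(1)[OF q, of "- x" "- y"] neg[of "x + y"]
      by (simp add: neg)
    show "q (r *\<^sub>R x) = r *\<^sub>R q x" for r x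
    proof (cases "0 \<le> r")
      case False
      then have "q ((- r) *\<^sub>R x) = - r * q x" by (intro sublinearD(2)[OF q]) simp
      then show ?thesis using neg[of "r *\<^sub>R x"] by simp
    qed (simp add: sublinearD(2)[OF q])
  qed
  then show ?thesis using qp by (rule that)
qed

text \<open>
  The functionals are only real-linear, over complex scalars too; \<open>weakly_convergent_to_iff\<close> below
  shows that they determine weak convergence in either case.
\<close>

definition dual_ball :: "('a::real_normed_vector \<Rightarrow> real) set" where
  "dual_ball = {f. linear f \<and> (\<forall>x. \<bar>f x\<bar> \<le> norm x)}"

lemma dual_ballI:
  assumes "linear f" "\<And>x. f x \<le> norm x"
  shows "f \<in> dual_ball"
proof -
  have "- f x \<le> norm x" for x
    using assms(2)[of "- x"] linear_neg[OF assms(1)] by simp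
  then show ?thesis using assms by (auto simp: dual_ball_def abs_le_iff)
qed

lemma dual_ballD:
  assumes "f \<in> dual_ball"
  shows "linear f" "\<bar>f x\<bar> \<le> norm x" "f x \<le> norm x"
  using assms by (auto simp: dual_ball_def abs_le_iff)

lemma sublinear_norm: "sublinear (norm :: 'a::real_normed_vector \<Rightarrow> real)"
  by (auto simp: sublinear_def norm_triangle_ineq)

text \<open>
  All functionals used below come from this form of the theorem: a consistent family of lower
  bounds \<open>r \<le> f v\<close>, closed under the cone operations, is realised by some \<open>f\<close> in the dual ball.
\<close>

theorem mazur_orlicz:
  fixes G :: "('a::real_normed_vector \<times> real) set"
  assumes zero: "(0, 0) \<in> G"
    and add: "\<And>v r w s. (v, r) \<in> G \<Longrightarrow> (w, s) \<in> G \<Longrightarrow> (v + w, r + s) \<in> G"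
    and scale: "\<And>t v r. (v, r) \<in> G \<Longrightarrow> 0 \<le> t \<Longrightarrow> (t *\<^sub>R v, t * r) \<in> G"
    and below: "\<And>v r. (v, r) \<in> G \<Longrightarrow> r \<le> norm v"
  obtains f where "f \<in> dual_ball" "\<And>v r. (v, r) \<in> G \<Longrightarrow> r \<le> f v"
proof -
  obtain q where q: "sublinear q" "\<And>x v r. (v, r) \<in> G \<Longrightarrow> q x \<le> norm (x + v) - r"
    using sublinear_cone_infimum[OF sublinear_norm zero add scale below] by blast
  obtain f where f: "linear f" "\<And>x. f x \<le> q x"
    using hahn_banach[OF q(1)] by blast
  have "f x \<le> norm x" for x
    using f(2)[of x] q(2)[OF zero, of x] by simp
  moreover have "r \<le> f v" if "(v, r) \<in> G" for v r
    using f(2)[of "- v"] q(2)[OF that, of "- v"] linear_neg[OF f(1), of v] by simp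
  ultimately show ?thesis using f(1) by (intro that[of f] dual_ballI)
qed

lemma norming_functional:
  fixes x :: "'a::real_normed_vector"
  obtains f where "f \<in> dual_ball" "f x = norm x"
proof -
  define G where "G = {(t *\<^sub>R x, t * norm x) |t. 0 \<le> t}"
  obtain f where f: "f \<in> dual_ball" "\<And>v r. (v, r) \<in> G \<Longrightarrow> r \<le> f v"
  proof (rule mazur_orlicz[of G])
    show "(0, 0) \<in> G" unfolding G_def by (auto intro!: exI[of _ 0])
    show "(v + w, r + s) \<in> G" if "(v, r) \<in> G" "(w, s) \<in> G" for v r w s
      using that unfolding G_def by clarsimp (metis add_nonneg_nonneg distrib_right scaleR_left_distrib)
    show "(t *\<^sub>R v, t * r) \<in> G" if "(v, r) \<in> G" "0 \<le> t" for t v r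
      using that unfolding G_def by clarsimp (metis mult_nonneg_nonneg mult.assoc)
    show "r \<le> norm v" if "(v, r) \<in> G" for v r
      using that by (auto simp: G_def)
  qed (use that in blast)
  have "(x, norm x) \<in> G" unfolding G_def by (auto intro!: exI[of _ 1])
  then have "f x = norm x"
    using f(2) dual_ballD(3)[OF f(1), of x] by (simp add: order_antisym)
  then show ?thesis using f(1) that by blast
qed

lemma separating_functional:
  fixes W :: "'a::real_normed_vector set"
  assumes W: "subspace W" "closed W" and l: "l \<notin> W"
  obtains f where "f \<in> dual_ball" "\<And>w. w \<in> W \<Longrightarrow> f w = 0" "0 < f l"
proof -
  define d where "d = infdist l W"
  have W0: "0 \<in> W" using W(1) by (simp add: subspace_0)
  have d: "0 < d"
    unfolding d_def using infdist_pos_not_in_closed[OF W(2)] W0 l by blast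
  define G where "G = {(w + t *\<^sub>R l, t * d) |w t. w \<in> W \<and> 0 \<le> t}"
  have G: "(w + t *\<^sub>R l, t * d) \<in> G" if "w \<in> W" "0 \<le> t" for w t
    using that by (auto simp: G_def)
  obtain f where f: "f \<in> dual_ball" "\<And>v r. (v, r) \<in> G \<Longrightarrow> r \<le> f v"
  proof (rule mazur_orlicz[of G])
    show "(0, 0) \<in> G" using G[OF W0, of 0] by simp
  next
    fix v r v' s assume "(v, r) \<in> G" "(v', s) \<in> G"
    then obtain w t w' t' where *: "v = w + t *\<^sub>R l" "r = t * d" "w \<in> W" "0 \<le> t"
      "v' = w' + t' *\<^sub>R l" "s = t' * d" "w' \<in> W" "0 \<le> t'" by (auto simp: G_def)
    have "((w + w') + (t + t') *\<^sub>R l, (t + t') * d) \<in> G"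
      using * W(1) by (intro G) (auto simp: subspace_add)
    then show "(v + v', r + s) \<in> G" using * by (simp add: algebra_simps)
  next
    fix c :: real and v r assume "(v, r) \<in> G" and c: "0 \<le> c"
    then obtain w t where *: "v = w + t *\<^sub>R l" "r = t * d" "w \<in> W" "0 \<le> t"
      by (auto simp: G_def)
    have "(c *\<^sub>R w + (c * t) *\<^sub>R l, (c * t) * d) \<in> G"
      using * W(1) c by (intro G) (auto simp: subspace_scale)
    then show "(c *\<^sub>R v, c * r) \<in> G" using * by (simp add: algebra_simps)
  next
    fix v r assume "(v, r) \<in> G"
    then obtain w t where *: "v = w + t *\<^sub>R l" "r = t * d" "w \<in> W" "0 \<le> t"
      by (auto simp: G_def)
    show "r \<le> norm v"
    proof (cases "t = 0")
      case False
      then have t: "0 < t" using * by simp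
      have "d \<le> dist l ((- (1/t)) *\<^sub>R w)"
        unfolding d_def using * W(1) by (intro infdist_le subspace_scale)
      then have "t * d \<le> t * norm (l + (1/t) *\<^sub>R w)"
        using t by (intro mult_left_mono) (auto simp: dist_norm)
      also have "\<dots> = norm (t *\<^sub>R (l + (1/t) *\<^sub>R w))"
        using t by simp
      also have "t *\<^sub>R (l + (1/t) *\<^sub>R w) = v"
        using t * by (simp add: scaleR_right_distrib add.commute)
      finally show ?thesis using * by simp
    qed (use * in simp)
  qed (use that in blast)
  have "f w = 0" if "w \<in> W" for w
  proof -
    have "(w, 0) \<in> G" "(- w, 0) \<in> G"
      using G[OF that, of 0] G[OF subspace_neg[OF W(1) that], of 0] by auto
    then show ?thesis
      using f(2)[of w 0] f(2)[of "- w" 0] linear_neg[OF dual_ballD(1)[OF f(1)], of w] by simp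
  qed
  moreover have "d \<le> f l"
    using f(2)[OF G[OF W0, of 1]] by simp
  ultimately show ?thesis using f(1) d that by fastforce
qed


section \<open>Weak limits of sequences\<close>

definition weak_limit :: "(nat \<Rightarrow> 'a::real_normed_vector) \<Rightarrow> 'a \<Rightarrow> bool" where
  "weak_limit x l \<longleftrightarrow> (\<forall>f\<in>dual_ball. (\<lambda>n. f (x n)) \<longlonglongrightarrow> f l)"

lemma weak_limitD: "weak_limit x l \<Longrightarrow> f \<in> dual_ball \<Longrightarrow> (\<lambda>n. f (x n)) \<longlonglongrightarrow> f l"
  by (auto simp: weak_limit_def)

lemma weak_limit_subseq: "weak_limit x l \<Longrightarrow> strict_mono r \<Longrightarrow> weak_limit (x \<circ> r) l"
  unfolding weak_limit_def using LIMSEQ_subseq_LIMSEQ by (fastforce simp: o_def)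

lemma dual_ball_separates_points:
  assumes "\<And>f. f \<in> dual_ball \<Longrightarrow> f l = f l'"
  shows "l = l'"
proof -
  obtain f where f: "f \<in> dual_ball" "f (l - l') = norm (l - l')"
    by (rule norming_functional)
  then show ?thesis
    using assms[OF f(1)] by (simp add: linear_diff[OF dual_ballD(1)])
qed

lemma weak_limit_unique: "weak_limit x l \<Longrightarrow> weak_limit x l' \<Longrightarrow> l = l'"
  by (metis dual_ball_separates_points weak_limitD LIMSEQ_unique)

lemma weak_limit_diff_const: "weak_limit x l \<Longrightarrow> weak_limit (\<lambda>n. x n - a) (l - a)"
  unfolding weak_limit_def by (auto simp: linear_diff[OF dual_ballD(1)] intro!: tendsto_diff)

lemma norm_limit_imp_weak_limit:
  assumes "x \<longlonglongrightarrow> l"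
  shows "weak_limit x l"
  unfolding weak_limit_def
proof
  fix f :: "'a \<Rightarrow> real" assume f: "f \<in> dual_ball"
  have "(\<lambda>n. f (x n - l)) \<longlonglongrightarrow> 0"
  proof (rule Lim_null_comparison)
    show "\<forall>\<^sub>F n in sequentially. norm (f (x n - l)) \<le> norm (x n - l)"
      using dual_ballD(2)[OF f] by simp
    show "(\<lambda>n. norm (x n - l)) \<longlonglongrightarrow> 0"
      using assms by (simp add: LIM_zero tendsto_norm_zero)
  qed
  then show "(\<lambda>n. f (x n)) \<longlonglongrightarrow> f l"
    by (simp add: linear_diff[OF dual_ballD(1)[OF f]] LIM_zero_cancel)
qed

text \<open>
  Mazur's theorem for subspaces, by separation.
\<close>

lemma weak_limit_in_closed_subspace:
  assumes "subspace W" "closed W" "\<And>n. x n \<in> W" "weak_limit x l"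
  shows "l \<in> W"
proof (rule ccontr)
  assume "l \<notin> W"
  then obtain f where f: "f \<in> dual_ball" "\<And>w. w \<in> W \<Longrightarrow> f w = 0" "0 < f l"
    using separating_functional[OF assms(1,2)] by metis
  have "(\<lambda>n. f (x n)) \<longlonglongrightarrow> f l" by (rule weak_limitD[OF assms(4) f(1)])
  then show False using f assms(3) by (simp add: LIMSEQ_const_iff)
qed

subsection \<open>Rational combinations\<close>

text \<open>
  The coefficients are listed together with their indices. Hence sums correspond to appended lists,
  the combinations form a countable set, and each depends on finitely many explicit terms of \<open>c\<close>.
\<close>

definition rat_comb :: "(nat \<Rightarrow> 'a::real_vector) \<Rightarrow> (nat \<times> rat) list \<Rightarrow> 'a" where
  "rat_comb c q = (\<Sum>(i, t)\<leftarrow>q. real_of_rat t *\<^sub>R c i)"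

lemma rat_comb_cong: "(\<And>i. i \<in> fst ` set q \<Longrightarrow> c i = c' i) \<Longrightarrow> rat_comb c q = rat_comb c' q"
  unfolding rat_comb_def by (rule arg_cong[where f = sum_list], rule map_cong) force+

lemma subspace_closure_rat_comb:
  fixes c :: "nat \<Rightarrow> 'a::real_normed_vector"
  shows "subspace (closure (range (rat_comb c)))"
proof (rule subspaceI)
  let ?S = "range (rat_comb c)"
  have "0 = rat_comb c []" by (simp add: rat_comb_def)
  then show "0 \<in> closure ?S" by (metis closure_subset rangeI subsetD)
  have add: "x + y \<in> ?S" if xy: "x \<in> ?S" "y \<in> ?S" for x y
  proof -
    obtain p q where "x = rat_comb c p" "y = rat_comb c q" using xy by (elim rangeE)
    then have "x + y = rat_comb c (p @ q)" by (simp add: rat_comb_def)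
    then show ?thesis by blast
  qed
  have scale: "real_of_rat s *\<^sub>R x \<in> ?S" if x: "x \<in> ?S" for x s
  proof -
    obtain p where "x = rat_comb c p" using x by (elim rangeE)
    moreover have "real_of_rat s *\<^sub>R rat_comb c p = rat_comb c (map (\<lambda>(i, t). (i, s * t)) p)"
      by (induction p) (auto simp: rat_comb_def scaleR_right_distrib of_rat_mult)
    ultimately show ?thesis by auto
  qed
  show "x + y \<in> closure ?S" if x: "x \<in> closure ?S" and y: "y \<in> closure ?S" for x y
  proof -
    obtain a where a: "\<forall>n. a n \<in> ?S" "a \<longlonglongrightarrow> x"
      using x unfolding closure_sequential by (elim exE conjE)
    obtain b where b: "\<forall>n. b n \<in> ?S" "b \<longlonglongrightarrow> y"
      using y unfolding closure_sequential by (elim exE conjE)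
    show ?thesis
      unfolding closure_sequential
      by (rule exI[of _ "\<lambda>n. a n + b n"]) (use a b add in \<open>simp add: tendsto_add\<close>)
  qed
  show "s *\<^sub>R x \<in> closure ?S" if x: "x \<in> closure ?S" for s x
  proof -
    obtain a where a: "\<forall>n. a n \<in> ?S" "a \<longlonglongrightarrow> x"
      using x unfolding closure_sequential by (elim exE conjE)
    have "s \<in> closure \<rat>" by (simp add: Rats_closure_real)
    then obtain t where t: "\<forall>n. t n \<in> \<rat>" "t \<longlonglongrightarrow> s"
      unfolding closure_sequential by (elim exE conjE)
    have "t n *\<^sub>R a n \<in> ?S" for n
    proof -
      have "t n \<in> \<rat>" using t(1) by (rule spec)
      then obtain u where u: "t n = real_of_rat u" by (elim Rats_cases)
      have "a n \<in> ?S" using a(1) by (rule spec)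
      then show ?thesis unfolding u by (rule scale)
    qed
    moreover have "(\<lambda>n. t n *\<^sub>R a n) \<longlonglongrightarrow> s *\<^sub>R x"
      using a t by (intro tendsto_scaleR)
    ultimately show ?thesis
      unfolding closure_sequential by (intro exI[of _ "\<lambda>n. t n *\<^sub>R a n"]) simp
  qed
qed

lemma weak_limit_in_closure_rat_comb:
  assumes "weak_limit x l" "\<And>n. x n \<in> range c"
  shows "l \<in> closure (range (rat_comb c))"
proof (rule weak_limit_in_closed_subspace[OF subspace_closure_rat_comb _ _ assms(1)])
  fix n
  obtain i where "x n = c i" using assms(2)[of n] by auto
  then have "x n = rat_comb c [(i, 1)]" by (simp add: rat_comb_def)
  then show "x n \<in> closure (range (rat_comb c))" by (metis closure_subset rangeI subsetD)
qed simp

text \<open>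
  Take for each rational combination \<open>v\<close> a functional \<open>g\<close> with \<open>g v = \<parallel>v\<parallel>\<close>. If all of them vanish at
  \<open>w = l - l'\<close>, then \<open>\<parallel>v\<parallel> = g (v - w) \<le> \<parallel>v - w\<parallel>\<close>, and \<open>v\<close> can be chosen arbitrarily close to \<open>w\<close>,
  because weak limits stay in the closed span.
\<close>

lemma countable_separating_functionals:
  fixes c :: "nat \<Rightarrow> 'a::real_normed_vector"
  shows "\<exists>g :: nat \<Rightarrow> 'a \<Rightarrow> real. (\<forall>i. g i \<in> dual_ball) \<and>
    (\<forall>x x' l l'. weak_limit x l \<and> weak_limit x' l' \<and> range x \<subseteq> range c \<and> range x' \<subseteq> range c \<and>
      (\<forall>i. g i l = g i l') \<longrightarrow> l = l')"
proof -
  have "\<forall>i. \<exists>f. f \<in> dual_ball \<and> f (rat_comb c (from_nat i)) = norm (rat_comb c (from_nat i))"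
    using norming_functional by blast
  then obtain g where g: "\<And>i. g i \<in> dual_ball"
    "\<And>i. g i (rat_comb c (from_nat i)) = norm (rat_comb c (from_nat i))"
    by metis
  show ?thesis
  proof (intro exI[of _ g] conjI allI impI, rule g, elim conjE)
    fix x x' l l'
    assume lim: "weak_limit x l" "weak_limit x' l'" "range x \<subseteq> range c" "range x' \<subseteq> range c"
      and eq: "\<forall>i. g i l = g i l'"
    let ?w = "l - l'"
    have w: "?w \<in> closure (range (rat_comb c))"
      using lim by (intro subspace_diff subspace_closure_rat_comb)
        (rule weak_limit_in_closure_rat_comb, assumption, blast)+
    have "norm ?w \<le> e" if e: "0 < e" for e
    proof -
      obtain q where q: "dist (rat_comb c q) ?w < e / 2"
        using w e unfolding closure_approachable by (metis half_gt_zero rangeE)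
      define i where "i = to_nat q"
      have "norm (rat_comb c q) = g i (rat_comb c q)"
        using g(2)[of i] by (simp add: i_def)
      also have "\<dots> = g i (rat_comb c q - ?w)"
        using eq[THEN spec, of i] by (simp add: linear_diff[OF dual_ballD(1)[OF g(1)]])
      also have "\<dots> \<le> norm (rat_comb c q - ?w)"
        by (rule dual_ballD(3)[OF g(1)])
      finally have "norm (rat_comb c q) < e / 2"
        using q by (simp add: dist_norm)
      moreover have "norm ?w \<le> norm (rat_comb c q) + norm (rat_comb c q - ?w)"
        using norm_triangle_sub[of ?w "rat_comb c q"] by (simp add: norm_minus_commute)
      ultimately show ?thesis using q by (simp add: dist_norm)
    qed
    then have "norm ?w \<le> 0" by (rule field_le_epsilon[where y = 0, simplified])
    then show "l = l'" by simp
  qed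
qed

section \<open>Ultrafilters\<close>

definition ultrafilter :: "'a filter \<Rightarrow> bool" where
  "ultrafilter U \<longleftrightarrow> U \<noteq> bot \<and> (\<forall>P. eventually P U \<or> eventually (\<lambda>x. \<not> P x) U)"

text \<open>
  A minimal proper filter \<open>U\<close> below \<open>F\<close> is an ultrafilter: if \<open>P\<close> is compatible with \<open>U\<close>, adding \<open>P\<close> to
  \<open>U\<close> gives a proper filter, which by minimality is \<open>U\<close> itself.
\<close>

lemma exists_ultrafilter_le:
  fixes F :: "'a filter"
  assumes "F \<noteq> bot"
  obtains U where "ultrafilter U" "U \<le> F"
proof -
  define A where "A = {G. G \<noteq> bot \<and> G \<le> F}"
  define P where "P G G' \<longleftrightarrow> G' \<le> G" for G G' :: "'a filter"
  have "\<exists>m\<in>A. \<forall>a\<in>A. P m a \<longrightarrow> a = m"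
  proof (rule predicate_Zorn)
    show "partial_order_on A (relation_of P A)"
      by (rule partial_order_on_relation_ofI) (auto simp: P_def)
  next
    fix C assume C: "C \<in> Chains (relation_of P A)"
    note CA = Chains_relation_of_dest(1)[OF C] and chain = Chains_relation_of_dest(2)[OF C]
    show "\<exists>u\<in>A. \<forall>a\<in>C. P a u"
    proof (cases "C = {}")
      case True
      then show ?thesis using assms by (auto simp: A_def)
    next
      case ne: False
      have least: "\<exists>m\<in>X. \<forall>G\<in>X. m \<le> G" if "finite X" "X \<noteq> {}" "X \<subseteq> C" for X
        using that
      proof (induction X rule: finite_ne_induct)
        case (insert G X)
        then obtain m where m: "m \<in> X" "\<forall>G\<in>X. m \<le> G" by auto
        consider "m \<le> G" | "G \<le> m"
          using chain[of m G] insert.prems m(1) by (auto simp: P_def)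
        then show ?case
        proof cases
          case 1
          then show ?thesis using m by (intro bexI[of _ m]) auto
        next
          case 2
          then show ?thesis using m by (intro bexI[of _ G]) (auto intro: order_trans)
        qed
      qed auto
      have "(INF G\<in>C. G) \<noteq> bot"
      proof (rule INF_filter_not_bot)
        fix X assume X: "X \<subseteq> C" "finite X"
        show "(INF G\<in>X. G) \<noteq> bot"
        proof (cases "X = {}")
          case True
          then show ?thesis using assms by (simp add: filter_eq_iff eventually_top trivial_limit_def) blast
        next
          case False
          then obtain m where m: "m \<in> X" "\<forall>G\<in>X. m \<le> G" using least X by blast
          then have "(INF G\<in>X. G) = m" by (intro antisym INF_lower INF_greatest) auto
          then show ?thesis using m X CA by (auto simp: A_def)
        qed
      qed
      moreover have "(INF G\<in>C. G) \<le> F"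
        using ne CA by (auto simp: A_def intro: Inf_lower2)
      ultimately show ?thesis by (auto simp: A_def P_def intro!: bexI[of _ "INF G\<in>C. G"] Inf_lower)
    qed
  qed
  then obtain U where U: "U \<noteq> bot" "U \<le> F" and min: "\<And>G. G \<noteq> bot \<Longrightarrow> G \<le> F \<Longrightarrow> G \<le> U \<Longrightarrow> G = U"
    by (auto simp: A_def P_def)
  have "eventually P U \<or> eventually (\<lambda>x. \<not> P x) U" for P
  proof (cases "inf U (principal {x. P x}) = bot")
    case True
    then show ?thesis by (simp add: trivial_limit_def eventually_inf_principal)
  next
    case False
    then have "inf U (principal {x. P x}) = U"
      using U(2) by (intro min) (auto intro: le_infI1)
    moreover have "eventually P (inf U (principal {x. P x}))"
      by (simp add: eventually_inf_principal)
    ultimately show ?thesis by simp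
  qed
  then show ?thesis using U by (intro that[of U]) (auto simp: ultrafilter_def)
qed

lemma ultrafilter_bounded_convergent:
  fixes g :: "'a \<Rightarrow> real"
  assumes U: "ultrafilter U" and B: "eventually (\<lambda>x. \<bar>g x\<bar> \<le> B) U"
  shows "\<exists>l. (g \<longlongrightarrow> l) U"
proof -
  have "compact {- B..B}" by simp
  moreover have "filtermap g U \<noteq> bot" using U by (simp add: ultrafilter_def filtermap_bot_iff)
  moreover have "eventually (\<lambda>y. y \<in> {- B..B}) (filtermap g U)"
    using B by (auto simp: eventually_filtermap abs_le_iff elim: eventually_mono)
  ultimately obtain l where l: "inf (nhds l) (filtermap g U) \<noteq> bot"
    unfolding compact_filter by blast
  have "(g \<longlongrightarrow> l) U"
    unfolding tendsto_def
  proof (intro allI impI)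
    fix S assume S: "open S" "l \<in> S"
    show "eventually (\<lambda>x. g x \<in> S) U"
    proof (rule ccontr)
      assume "\<not> eventually (\<lambda>x. g x \<in> S) U"
      then have "eventually (\<lambda>x. g x \<notin> S) U" using U by (auto simp: ultrafilter_def)
      then have "eventually (\<lambda>y. y \<notin> S) (filtermap g U)" by (simp add: eventually_filtermap)
      moreover have "eventually (\<lambda>y. y \<in> S) (nhds l)" using S by (rule eventually_nhds_in_open)
      ultimately have "eventually (\<lambda>y. False) (inf (nhds l) (filtermap g U))"
        unfolding eventually_inf by blast
      then show False using l by (simp add: trivial_limit_def)
    qed
  qed
  then show ?thesis ..
qed


section \<open>The topology of sequentially open sets\<close>

text \<open>
  The topological arguments use only the following properties of convergence of order \<open>\<xi>\<close>.
\<close>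

locale weak_convergence_mode =
  fixes conv :: "(nat \<Rightarrow> 'a::real_normed_vector) \<Rightarrow> 'a \<Rightarrow> bool"
  assumes conv_subseq: "conv x l \<Longrightarrow> strict_mono r \<Longrightarrow> conv (x \<circ> r) l"
    and conv_const: "conv (\<lambda>_. l) l"
    and conv_weak_limit: "conv x l \<Longrightarrow> weak_limit x l"
begin

lemma conv_unique: "conv x l \<Longrightarrow> conv x l' \<Longrightarrow> l = l'"
  using conv_weak_limit weak_limit_unique by blast

lemma conv_subseq_unique: "conv x l \<Longrightarrow> strict_mono r \<Longrightarrow> conv (x \<circ> r) l' \<Longrightarrow> l = l'"
  using conv_subseq conv_unique by blast

definition seq_compact_for :: "'a set \<Rightarrow> bool" where
  "seq_compact_for K \<longleftrightarrow>
     (\<forall>x :: nat \<Rightarrow> _. range x \<subseteq> K \<longrightarrow> (\<exists>l\<in>K. \<exists>r :: nat \<Rightarrow> nat. strict_mono r \<and> conv (x \<circ> r) l))"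

definition seq_precompact_for :: "'a set \<Rightarrow> bool" where
  "seq_precompact_for K \<longleftrightarrow>
     (\<forall>x :: nat \<Rightarrow> _. range x \<subseteq> K \<longrightarrow> (\<exists>l r. strict_mono r \<and> conv (x \<circ> r) l))"

text \<open>
  The finest topology in which every \<open>conv\<close>-convergent sequence converges to its limit.
\<close>

definition seq_topology :: "'a topology" where
  "seq_topology = topology (\<lambda>S. \<forall>x l. conv x l \<and> l \<in> S \<longrightarrow> eventually (\<lambda>n. x n \<in> S) sequentially)"

lemma openin_seq_topology:
  "openin seq_topology S \<longleftrightarrow>
     (\<forall>x l. conv x l \<and> l \<in> S \<longrightarrow> eventually (\<lambda>n. x n \<in> S) sequentially)"
proof -
  have "istopology (\<lambda>S. \<forall>x l. conv x l \<and> l \<in> S \<longrightarrow> eventually (\<lambda>n. x n \<in> S) sequentially)"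
    unfolding istopology_def
  proof (intro conjI allI impI)
    fix \<K> x l
    assume "\<forall>K\<in>\<K>. \<forall>x l. conv x l \<and> l \<in> K \<longrightarrow> (\<forall>\<^sub>F n in sequentially. x n \<in> K)"
      and "conv x l \<and> l \<in> \<Union>\<K>"
    then obtain K where "K \<in> \<K>" "\<forall>\<^sub>F n in sequentially. x n \<in> K" by blast
    then show "\<forall>\<^sub>F n in sequentially. x n \<in> \<Union>\<K>" by (auto elim: eventually_mono)
  qed (auto simp: eventually_conj_iff)
  then show ?thesis by (simp add: seq_topology_def topology_inverse')
qed

lemma topspace_seq_topology [simp]: "topspace seq_topology = UNIV"
proof -
  have "openin seq_topology UNIV" by (simp add: openin_seq_topology)
  then show ?thesis using openin_subset by blast
qed

lemma closedin_seq_topology: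
  "closedin seq_topology C \<longleftrightarrow> (\<forall>x l. (\<forall>n. x n \<in> C) \<and> conv x l \<longrightarrow> l \<in> C)"
proof
  assume "closedin seq_topology C"
  then have "openin seq_topology (- C)" by (simp add: closedin_def Compl_eq_Diff_UNIV)
  then show "\<forall>x l. (\<forall>n. x n \<in> C) \<and> conv x l \<longrightarrow> l \<in> C"
    unfolding openin_seq_topology by fastforce
next
  assume C: "\<forall>x l. (\<forall>n. x n \<in> C) \<and> conv x l \<longrightarrow> l \<in> C"
  have "openin seq_topology (- C)"
    unfolding openin_seq_topology
  proof (intro allI impI, elim conjE)
    fix x l assume x: "conv x l" and l: "l \<in> - C"
    show "\<forall>\<^sub>F n in sequentially. x n \<in> - C"
    proof (rule ccontr)
      assume "\<not> ?thesis"
      then have "\<exists>\<^sub>\<infinity>n. x n \<in> C"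
        by (simp add: frequently_def cofinite_eq_sequentially)
      then obtain r :: "nat \<Rightarrow> nat" where r: "strict_mono r" "\<And>n. r n \<in> {n. x n \<in> C}"
        using infinite_enumerate[of "{n. x n \<in> C}"] unfolding INFM_iff_infinite by blast
      have "\<forall>n. (x \<circ> r) n \<in> C" using r(2) by simp
      then have "l \<in> C" using C conv_subseq[OF x r(1)] by blast
      then show False using l by simp
    qed
  qed
  then show "closedin seq_topology C" by (simp add: closedin_def Compl_eq_Diff_UNIV)
qed

subsection \<open>Compact sets are sequentially compact\<close>

text \<open>
  The dichotomy between a value taken infinitely often and infinitely many values.
\<close>

lemma constant_or_injective_subseq:
  fixes x :: "nat \<Rightarrow> 'b"
  obtains r :: "nat \<Rightarrow> nat" and l where "strict_mono r" "\<And>n. x (r n) = l"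
  | r :: "nat \<Rightarrow> nat" where "strict_mono r" "inj (x \<circ> r)"
proof (cases "finite (range x)")
  case True
  then obtain i where "infinite {n. x n = x i}"
    using pigeonhole_infinite[of UNIV x] by auto
  then obtain r :: "nat \<Rightarrow> nat" where r: "strict_mono r" "\<And>n. r n \<in> {n. x n = x i}"
    using infinite_enumerate by blast
  then show ?thesis by (intro that(1)[of r "x i"]) auto
next
  case False
  define f where "f y = (LEAST n. x n = y)" for y
  have f: "x (f y) = y" if "y \<in> range x" for y
    using that unfolding f_def by (metis (mono_tags, lifting) LeastI rangeE)
  then have inj: "inj_on f (range x)" by (metis inj_onI)
  then have "infinite (f ` range x)" using False finite_imageD by blast
  then obtain r :: "nat \<Rightarrow> nat" where r: "strict_mono r" "\<And>n. r n \<in> f ` range x"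
    using infinite_enumerate by blast
  have "f (x (r n)) = r n" for n
    using r(2)[of n] f by auto
  then have "inj (x \<circ> r)"
    by (metis (no_types, lifting) comp_apply injI r(1) strict_mono_eq)
  then show ?thesis using r(1) that(2) by blast
qed

lemma injective_imp_strict_mono_subseq:
  fixes \<phi> :: "nat \<Rightarrow> nat"
  assumes "inj \<phi>"
  obtains r :: "nat \<Rightarrow> nat" where "strict_mono r" "strict_mono (\<phi> \<circ> r)"
proof -
  have "\<exists>m>n. \<phi> n < \<phi> m" for n
  proof (rule ccontr)
    assume "\<not> (\<exists>m>n. \<phi> n < \<phi> m)"
    then have "\<phi> ` {n<..} \<subseteq> {..\<phi> n}" by auto
    then have "finite (\<phi> ` {n<..})" by (rule finite_subset) simp
    then have "finite {n<..}" using assms by (meson finite_imageD inj_on_subset subset_UNIV)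
    then show False by (simp add: infinite_Ioi)
  qed
  then obtain s where s: "\<And>n. n < s n" "\<And>n. \<phi> n < \<phi> (s n)" by metis
  define r where "r n = (s ^^ n) 0" for n
  have "strict_mono r" "strict_mono (\<phi> \<circ> r)"
    unfolding strict_mono_Suc_iff by (auto simp: r_def s)
  then show ?thesis by (rule that)
qed

text \<open>
  A convergent sequence in the tail is, up to passing to a subsequence, constant or a subsequence
  of \<open>t\<close>. So its limit lies in the tail or is one of the cluster points collected in \<open>Z\<close>.
\<close>

lemma closedin_tail:
  assumes "finite Z" and t: "\<And>(r :: nat \<Rightarrow> nat) p. strict_mono r \<Longrightarrow> conv (t \<circ> r) p \<Longrightarrow> p \<in> Z"
  shows "closedin seq_topology (t ` {m..} \<union> Z)"
  unfolding closedin_seq_topology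
proof (intro allI impI, elim conjE)
  fix s p assume s: "\<forall>n. s n \<in> t ` {m..} \<union> Z" and p: "conv s p"
  show "p \<in> t ` {m..} \<union> Z"
  proof (cases s rule: constant_or_injective_subseq)
    case (1 r l)
    then have "conv (\<lambda>_. l) p" using conv_subseq[OF p 1(1)] by (simp add: o_def)
    then have "p = l" using conv_unique conv_const by blast
    then show ?thesis using s 1(2) by metis
  next
    case (2 r)
    then have "finite {n. (s \<circ> r) n \<in> Z}"
      using finite_vimageI[OF assms(1), of "s \<circ> r"] by (simp add: vimage_def)
    then obtain N where N: "\<And>n. (s \<circ> r) n \<in> Z \<Longrightarrow> n < N"
      using finite_nat_set_iff_bounded by auto
    have "s (r (n + N)) \<in> t ` {m..}" for n
      using N[of "n + N"] s by auto
    then have "\<forall>n. \<exists>k. s (r (n + N)) = t k" by auto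
    then obtain \<phi> where \<phi>: "\<And>n. s (r (n + N)) = t (\<phi> n)" by metis
    have "inj \<phi>"
    proof (rule injI)
      fix i j assume "\<phi> i = \<phi> j"
      then have "(s \<circ> r) (i + N) = (s \<circ> r) (j + N)" using \<phi> by simp
      then show "i = j" using 2(2) by (simp add: inj_eq del: comp_apply)
    qed
    then obtain r' :: "nat \<Rightarrow> nat" where r': "strict_mono r'" "strict_mono (\<phi> \<circ> r')"
      by (rule injective_imp_strict_mono_subseq)
    have "strict_mono (\<lambda>n. r (r' n + N))"
      using 2(1) r'(1) by (simp add: strict_mono_def)
    from conv_subseq[OF p this] have "conv (t \<circ> (\<phi> \<circ> r')) p"
      by (simp add: o_def \<phi>)
    then show ?thesis using t r'(2) by blast
  qed
qed

text \<open>
  If a sequence with distinct terms in \<open>K\<close> had no subsequence converging in \<open>K\<close>, one could pass to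
  a subsequence with at most one cluster point, which lies outside \<open>K\<close>. The tails, with that point
  added, are then closed. They meet \<open>K\<close> in sets with the finite intersection property whose
  intersection is empty.
\<close>

lemma compactin_imp_seq_compact_for:
  assumes K: "compactin seq_topology K"
  shows "seq_compact_for K"
  unfolding seq_compact_for_def
proof (intro allI impI)
  fix x :: "nat \<Rightarrow> 'a" assume x: "range x \<subseteq> K"
  show "\<exists>l\<in>K. \<exists>r. strict_mono r \<and> conv (x \<circ> r) l"
  proof (cases x rule: constant_or_injective_subseq)
    case (1 r l)
    then have "x \<circ> r = (\<lambda>_. l)" by auto
    then have "conv (x \<circ> r) l" using conv_const by simp
    moreover have "l \<in> K" using 1(2)[of 0] x by auto
    ultimately show ?thesis using 1(1) by blast
  next
    case (2 r0)
    show ?thesis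
    proof (rule ccontr)
      assume neg: "\<not> ?thesis"
      have no_limit: "p \<notin> K" if "strict_mono r" "conv (x \<circ> r) p" for r :: "nat \<Rightarrow> nat" and p
        using neg that by blast
      obtain s :: "nat \<Rightarrow> nat" and Z where s: "strict_mono s" and Z: "finite Z" "Z \<inter> K = {}" and inj: "inj (x \<circ> s)"
        and lim: "\<And>r p. strict_mono r \<Longrightarrow> conv (x \<circ> s \<circ> (r :: nat \<Rightarrow> nat)) p \<Longrightarrow> p \<in> Z"
      proof (cases "\<exists>r l. strict_mono r \<and> conv (x \<circ> r0 \<circ> r) l")
        case True
        then obtain r :: "nat \<Rightarrow> nat" and l where r: "strict_mono r" "conv (x \<circ> r0 \<circ> r) l" by blast
        show ?thesis
        proof (rule that[of "r0 \<circ> r" "{l}"])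
          show mono: "strict_mono (r0 \<circ> r)" using 2(1) r(1) by (rule strict_mono_o)
          show "{l} \<inter> K = {}" using no_limit[OF mono] r(2) by (simp add: o_assoc)
          show "inj (x \<circ> (r0 \<circ> r))"
            using inj_compose[OF 2(2) strict_mono_imp_inj_on[OF r(1)]] by (simp add: o_assoc)
          show "p \<in> {l}" if "strict_mono r'" "conv (x \<circ> (r0 \<circ> r) \<circ> r') p" for r' :: "nat \<Rightarrow> nat" and p
            using conv_subseq_unique[OF r(2) that(1)] that(2) by (simp add: o_assoc)
        qed simp
      next
        case False
        then show ?thesis using 2 by (intro that[of r0 "{}"]) auto
      qed
      let ?t = "x \<circ> s"
      let ?T = "\<lambda>m. ?t ` {m..} \<union> Z"
      have closed: "closedin seq_topology (?T m)" for m
        using Z(1) lim by (rule closedin_tail)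
      have fip: "K \<inter> \<Inter>\<F> \<noteq> {}" if \<F>: "finite \<F>" "\<F> \<subseteq> range ?T" for \<F>
      proof -
        obtain M where M: "finite M" "\<F> = ?T ` M"
          using finite_subset_image[OF \<F>] by auto
        define m where "m = Max (insert 0 M)"
        have "?t m \<in> ?T i" if "i \<in> M" for i
          using that M(1) by (simp add: m_def)
        then have "?t m \<in> K \<inter> \<Inter>\<F>" using x M(2) by auto
        then show ?thesis by blast
      qed
      then have "K \<inter> \<Inter>(range ?T) \<noteq> {}"
        using K closed unfolding compactin_fip by (metis (no_types, lifting) imageE)
      then obtain p where p: "p \<in> K" "\<And>m. p \<in> ?T m" by blast
      then have *: "\<And>m. p \<in> ?t ` {m..}" using Z(2) by blast
      then obtain i where i: "p = ?t i" by blast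
      obtain j where "Suc i \<le> j" "p = ?t j" using *[of "Suc i"] by auto
      then show False using inj i by (metis injD not_less_eq_eq order_refl)
    qed
  qed
qed

subsection \<open>Sequentially compact sets are compact\<close>

lemma seq_compact_imp_bounded_functional:
  assumes K: "seq_compact_for K" and f: "f \<in> dual_ball"
  shows "\<exists>B. \<forall>x\<in>K. \<bar>f x\<bar> \<le> B"
proof (rule ccontr)
  assume "\<not> ?thesis"
  then have "\<forall>n. \<exists>x. x \<in> K \<and> real n < \<bar>f x\<bar>" by (metis not_less)
  then obtain x where x: "\<And>n. x n \<in> K" "\<And>n. real n < \<bar>f (x n)\<bar>" by metis
  then obtain l r where r: "strict_mono r" "conv (x \<circ> r) l"
    using K unfolding seq_compact_for_def by blast
  then have "(\<lambda>n. f ((x \<circ> r) n)) \<longlonglongrightarrow> f l"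
    using conv_weak_limit weak_limitD f by blast
  then have "Bseq (\<lambda>n. f ((x \<circ> r) n))"
    by (intro convergent_imp_Bseq) (auto simp: convergent_def)
  then obtain B where B: "\<And>n. \<bar>f (x (r n))\<bar> \<le> B" unfolding Bseq_def by auto
  obtain n where "B < real n" using reals_Archimedean2 by blast
  then show False
    using B[of n] x(2)[of "r n"] seq_suble[OF r(1), of n] by linarith
qed

text \<open>
  This is the substance of the Eberlein--Smulian theorem, proved after Whitley. The function
  \<open>\<phi>\<close> is the limit of the ultrafilter in the bidual; it must be evaluation at a point of \<open>C\<close>.
  Choose terms \<open>a n \<in> K \<inter> C\<close> inductively such that \<open>f (a n)\<close> approximates \<open>\<phi> f\<close> for a growing finite set of
  functionals \<open>f\<close>: for each rational combination \<open>v\<close> of earlier terms, one \<open>f = F v\<close> that nearly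
  maximises \<open>\<bar>\<phi> f - f v\<bar>\<close> over the dual ball. A subsequence converges to some \<open>x \<in> C\<close>, so that
  \<open>\<phi> (F v) = F v x\<close> for all \<open>v\<close>. Since \<open>x\<close> is a norm limit of such \<open>v\<close>, the near-maximal value
  \<open>\<bar>F v (x - v)\<bar> \<le> \<parallel>x - v\<parallel>\<close> is arbitrarily small, which forces \<open>\<phi> g = g x\<close> for every \<open>g\<close>.
\<close>

lemma ultrafilter_limit_attained:
  assumes U: "ultrafilter U" and K: "seq_compact_for K" and C: "closedin seq_topology C"
    and ev: "eventually (\<lambda>x. x \<in> K \<inter> C) U"
    and \<phi>: "\<And>f. f \<in> dual_ball \<Longrightarrow> (f \<longlongrightarrow> \<phi> f) U"
  shows "\<exists>x\<in>C. \<forall>f\<in>dual_ball. \<phi> f = f x"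
proof -
  \<comment> \<open>Truncation at 1 makes the supremum finite, so that a near-maximal functional exists even if
    \<open>\<phi>\<close> is unbounded on the dual ball.\<close>
  have "\<exists>F. \<forall>v. F v \<in> dual_ball \<and> (\<forall>g\<in>dual_ball. min 1 \<bar>\<phi> g - g v\<bar> \<le> 2 * \<bar>\<phi> (F v) - F v v\<bar>)"
  proof (rule choice, rule allI)
    fix v
    define S where "S = (\<lambda>g. min 1 \<bar>\<phi> g - g v\<bar>) ` dual_ball"
    have ne: "S \<noteq> {}" by (metis S_def empty_iff image_is_empty norming_functional)
    have bdd: "bdd_above S" unfolding S_def by (rule bdd_aboveI2[of _ _ 1]) simp
    have le: "min 1 \<bar>\<phi> g - g v\<bar> \<le> Sup S" if "g \<in> dual_ball" for g
      using that bdd by (intro cSup_upper) (auto simp: S_def)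
    show "\<exists>f. f \<in> dual_ball \<and> (\<forall>g\<in>dual_ball. min 1 \<bar>\<phi> g - g v\<bar> \<le> 2 * \<bar>\<phi> f - f v\<bar>)"
    proof (cases "Sup S \<le> 0")
      case True
      obtain f :: "'a \<Rightarrow> real" where f: "f \<in> dual_ball" using norming_functional by blast
      have "min 1 \<bar>\<phi> g - g v\<bar> \<le> 2 * \<bar>\<phi> f - f v\<bar>" if "g \<in> dual_ball" for g
      proof -
        have "min 1 \<bar>\<phi> g - g v\<bar> \<le> 0" using le[OF that] True by (rule order_trans)
        also have "0 \<le> 2 * \<bar>\<phi> f - f v\<bar>" by simp
        finally show ?thesis .
      qed
      then show ?thesis using f by (intro exI[of _ f]) simp
    next
      case False
      then have "Sup S / 2 < Sup S" by simp
      then obtain y where "y \<in> S" "Sup S / 2 < y" using less_cSup_iff[OF ne bdd] by blast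
      then obtain f where f: "f \<in> dual_ball" "Sup S / 2 < min 1 \<bar>\<phi> f - f v\<bar>"
        unfolding S_def by blast
      have "min 1 \<bar>\<phi> g - g v\<bar> \<le> 2 * \<bar>\<phi> f - f v\<bar>" if "g \<in> dual_ball" for g
      proof -
        have "min 1 \<bar>\<phi> g - g v\<bar> \<le> Sup S" by (rule le[OF that])
        also have "Sup S \<le> 2 * min 1 \<bar>\<phi> f - f v\<bar>" using f(2) by argo
        also have "\<dots> \<le> 2 * \<bar>\<phi> f - f v\<bar>" by simp
        finally show ?thesis .
      qed
      then show ?thesis using f(1) by (intro exI[of _ f]) simp
    qed
  qed
  then obtain F where F': "\<forall>v. F v \<in> dual_ball \<and>
      (\<forall>g\<in>dual_ball. min 1 \<bar>\<phi> g - g v\<bar> \<le> 2 * \<bar>\<phi> (F v) - F v v\<bar>)" ..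
  then have F: "F v \<in> dual_ball"
    and F_max: "g \<in> dual_ball \<Longrightarrow> min 1 \<bar>\<phi> g - g v\<bar> \<le> 2 * \<bar>\<phi> (F v) - F v v\<bar>" for v g
    by simp_all
  define P where "P a n r \<longleftrightarrow> r \<in> K \<inter> C \<and> (\<forall>i\<le>n. fst ` set (from_nat i :: (nat \<times> rat) list) \<subseteq> {..<n} \<longrightarrow>
      \<bar>F (rat_comb a (from_nat i)) r - \<phi> (F (rat_comb a (from_nat i)))\<bar> < 1 / real (Suc n))"
    for a n r
  have "\<exists>a. \<forall>n. P a n (a n)"
  proof (rule dependent_wf_choice[OF wf_less])
    fix a b :: "nat \<Rightarrow> 'a" and n r
    assume ab: "\<And>k. (k, n) \<in> {(x, y). x < y} \<Longrightarrow> a k = b k"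
    have "rat_comb a q = rat_comb b q" if "fst ` set q \<subseteq> {..<n}" for q
      using that ab by (intro rat_comb_cong) auto
    then show "P a n r = P b n r" by (auto simp: P_def)
  next
    fix n and a :: "nat \<Rightarrow> 'a"
    have "\<forall>\<^sub>F r in U. \<bar>F v r - \<phi> (F v)\<bar> < 1 / real (Suc n)" for v
      using tendstoD[OF \<phi>[OF F[of v]], of "1 / real (Suc n)"] by (simp add: dist_real_def)
    then have "\<forall>\<^sub>F r in U. \<forall>i\<in>{..n}. \<bar>F (rat_comb a (from_nat i)) r - \<phi> (F (rat_comb a (from_nat i)))\<bar> < 1 / real (Suc n)"
      by (intro eventually_ball_finite) auto
    with ev have "\<forall>\<^sub>F r in U. P a n r"
      by eventually_elim (auto simp: P_def)
    moreover have "U \<noteq> bot" using U by (simp add: ultrafilter_def)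
    ultimately show "\<exists>r. P a n r" using eventually_happens by blast
  qed
  then obtain a where a: "\<And>n. P a n (a n)" by blast
  then have aKC: "\<And>n. a n \<in> K" "\<And>n. a n \<in> C" by (auto simp: P_def)
  then obtain x r where r: "strict_mono r" and x: "conv (a \<circ> r) x"
    using K unfolding seq_compact_for_def by blast
  have weak: "weak_limit (a \<circ> r) x" using x by (rule conv_weak_limit)
  have "x \<in> C" using C x aKC(2) unfolding closedin_seq_topology by (metis comp_apply)
  have agree: "\<phi> (F (rat_comb a q)) = F (rat_comb a q) x" for q
  proof -
    let ?f = "F (rat_comb a q)"
    define N where "N = Max (insert (to_nat q) (Suc ` fst ` set q))"
    have "k \<le> N" if "k \<in> insert (to_nat q) (Suc ` fst ` set q)" for k
      unfolding N_def using that by (intro Max_ge) auto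
    then have "to_nat q \<le> N" "\<And>i. i \<in> fst ` set q \<Longrightarrow> Suc i \<le> N"
      by (simp_all only: insertI1 insertI2 imageI)
    then have N: "to_nat q \<le> N" "fst ` set q \<subseteq> {..<N}"
      by (auto simp only: Suc_le_eq lessThan_iff subset_iff)
    have "\<bar>?f (a n) - \<phi> ?f\<bar> < 1 / real (Suc n)" if "N \<le> n" for n
    proof -
      have n: "to_nat q \<le> n" "fst ` set q \<subseteq> {..<n}"
        using N that by (auto dest: subsetD)
      have "\<forall>i\<le>n. fst ` set (from_nat i :: (nat \<times> rat) list) \<subseteq> {..<n} \<longrightarrow>
          \<bar>F (rat_comb a (from_nat i)) (a n) - \<phi> (F (rat_comb a (from_nat i)))\<bar> < 1 / real (Suc n)"
        using a[of n] unfolding P_def by (rule conjunct2)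
      from this[THEN spec, of "to_nat q"] show ?thesis
        unfolding from_nat_to_nat using n by blast
    qed
    then have "\<forall>\<^sub>F n in sequentially. norm (?f (a n) - \<phi> ?f) \<le> 1 / real (Suc n)"
      unfolding eventually_sequentially by (intro exI[of _ N]) (auto intro: less_imp_le)
    then have "(\<lambda>n. ?f (a n) - \<phi> ?f) \<longlonglongrightarrow> 0"
      by (rule Lim_null_comparison) (rule LIMSEQ_inverse_real_of_nat[unfolded inverse_eq_divide])
    then have "(\<lambda>n. ?f (a n)) \<longlonglongrightarrow> \<phi> ?f" by (rule LIM_zero_cancel)
    then have "(\<lambda>n. ?f ((a \<circ> r) n)) \<longlonglongrightarrow> \<phi> ?f"
      using LIMSEQ_subseq_LIMSEQ[OF _ r] by (fastforce simp: o_def)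
    then show ?thesis using weak_limitD[OF weak F] LIMSEQ_unique by blast
  qed
  have x_cl: "x \<in> closure (range (rat_comb a))"
    using weak by (rule weak_limit_in_closure_rat_comb) auto
  have "\<phi> g = g x" if g: "g \<in> dual_ball" for g
  proof -
    have "\<bar>\<phi> g - g x\<bar> \<le> 0 + e" if e: "0 < e" for e
    proof -
      define d where "d = min (1/3) (e/3)"
      have d: "0 < d" "d \<le> 1/3" "d \<le> e/3" using e by (auto simp: d_def)
      then obtain q where q: "norm (x - rat_comb a q) < d"
        using x_cl unfolding closure_approachable by (metis dist_norm dist_commute rangeE)
      let ?v = "rat_comb a q"
      have "\<bar>\<phi> (F ?v) - F ?v ?v\<bar> = \<bar>F ?v (x - ?v)\<bar>"
        by (simp add: agree linear_diff[OF dual_ballD(1)[OF F]])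
      also have "\<dots> \<le> norm (x - ?v)" by (rule dual_ballD(2)[OF F])
      also note q
      finally have "min 1 \<bar>\<phi> g - g ?v\<bar> < 2 * d"
        by (intro le_less_trans[OF F_max[OF g, of ?v]]) simp
      then have "\<bar>\<phi> g - g ?v\<bar> < 2 * d" using d by (auto simp: min_def split: if_splits)
      moreover have "\<bar>g x - g ?v\<bar> \<le> norm (x - ?v)"
        using dual_ballD(2)[OF g, of "x - ?v"] by (simp add: linear_diff[OF dual_ballD(1)[OF g]])
      ultimately show ?thesis using q d by linarith
    qed
    then have "\<bar>\<phi> g - g x\<bar> \<le> 0" by (rule field_le_epsilon)
    then show ?thesis by simp
  qed
  then show ?thesis using \<open>x \<in> C\<close> by blast
qed

text \<open>
  An ultrafilter containing \<open>K\<close> and the members of \<open>\<U>\<close> has, by the previous lemma, its bidual limit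
  represented by a point in each of these sets, and all these points coincide because the dual ball
  separates points.
\<close>

lemma seq_compact_for_imp_compactin:
  assumes K: "seq_compact_for K"
  shows "compactin seq_topology K"
  unfolding compactin_fip
proof (intro conjI allI impI, simp, elim conjE)
  fix \<U> assume closed: "\<forall>C\<in>\<U>. closedin seq_topology C"
    and fip: "\<forall>\<F>. finite \<F> \<and> \<F> \<subseteq> \<U> \<longrightarrow> K \<inter> \<Inter>\<F> \<noteq> {}"
  have closedK: "closedin seq_topology K"
    unfolding closedin_seq_topology
  proof (intro allI impI, elim conjE)
    fix x l assume "\<forall>n. x n \<in> K" and x: "conv x l"
    then obtain l' r where "l' \<in> K" "strict_mono r" "conv (x \<circ> r) l'"
      using K unfolding seq_compact_for_def by blast
    then show "l \<in> K" using conv_subseq_unique[OF x] by blast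
  qed
  have "(INF C\<in>insert K \<U>. principal (K \<inter> C)) \<noteq> bot"
  proof (rule INF_filter_not_bot)
    fix \<F> assume \<F>: "\<F> \<subseteq> insert K \<U>" "finite \<F>"
    then have "K \<inter> \<Inter>(\<F> - {K}) \<noteq> {}" using fip by blast
    then obtain p where p: "p \<in> K" "\<And>C. C \<in> \<F> \<Longrightarrow> p \<in> K \<inter> C" by blast
    then have "principal {p} \<le> (INF C\<in>\<F>. principal (K \<inter> C))"
      by (intro INF_greatest) auto
    then show "(INF C\<in>\<F>. principal (K \<inter> C)) \<noteq> bot"
      by (metis bot.extremum_unique empty_not_insert principal_eq_bot_iff)
  qed
  then obtain U where U: "ultrafilter U" "U \<le> (INF C\<in>insert K \<U>. principal (K \<inter> C))"
    using exists_ultrafilter_le by blast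
  have ev: "\<forall>\<^sub>F x in U. x \<in> K \<inter> C" if "C \<in> insert K \<U>" for C
  proof -
    have "U \<le> principal (K \<inter> C)" using U(2) that by (meson INF_lower order_trans)
    then show ?thesis by (simp add: le_principal)
  qed
  have "\<exists>l. (f \<longlongrightarrow> l) U" if f: "f \<in> dual_ball" for f
  proof -
    obtain B where "\<forall>x\<in>K. \<bar>f x\<bar> \<le> B"
      using seq_compact_imp_bounded_functional[OF K f] by blast
    then have "\<forall>\<^sub>F x in U. \<bar>f x\<bar> \<le> B"
      using ev[of K] by (auto elim: eventually_mono)
    then show ?thesis by (rule ultrafilter_bounded_convergent[OF U(1)])
  qed
  then obtain \<phi> where \<phi>: "\<And>f. f \<in> dual_ball \<Longrightarrow> (f \<longlongrightarrow> \<phi> f) U" by metis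
  have attained: "\<exists>x\<in>C. \<forall>f\<in>dual_ball. \<phi> f = f x" if "C \<in> insert K \<U>" for C
    using that closed closedK ev[OF that] by (intro ultrafilter_limit_attained[OF U(1) K] \<phi>) auto
  then obtain x where x: "x \<in> K" "\<forall>f\<in>dual_ball. \<phi> f = f x" by blast
  have "x \<in> C" if "C \<in> \<U>" for C
  proof -
    obtain y where y: "y \<in> C" "\<forall>f\<in>dual_ball. \<phi> f = f y" using attained \<open>C \<in> \<U>\<close> by blast
    have "x = y"
    proof (rule dual_ball_separates_points)
      fix f :: "'a \<Rightarrow> real" assume "f \<in> dual_ball"
      then show "f x = f y" using bspec[OF x(2)] bspec[OF y(2)] by (metis (no_types))
    qed
    then show ?thesis using y(1) by simp
  qed
  then show "K \<inter> \<Inter>\<U> \<noteq> {}" using x(1) by blast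
qed

theorem compactin_seq_topology_iff: "compactin seq_topology K \<longleftrightarrow> seq_compact_for K"
  using compactin_imp_seq_compact_for seq_compact_for_imp_compactin by blast

end


section \<open>Closures of sequentially precompact sets\<close>

lemma not_tendsto_subseq:
  fixes X :: "nat \<Rightarrow> 'b::metric_space"
  assumes "\<not> X \<longlonglongrightarrow> L"
  obtains e and s :: "nat \<Rightarrow> nat" where "0 < e" "strict_mono s" "\<forall>n. e \<le> dist (X (s n)) L"
proof -
  obtain e where e: "0 < e" "\<not> (\<forall>\<^sub>F n in sequentially. dist (X n) L < e)"
    using assms unfolding tendsto_iff by blast
  then have "infinite {n. e \<le> dist (X n) L}"
    unfolding cofinite_eq_sequentially[symmetric] eventually_cofinite by (simp add: not_less)
  then obtain s :: "nat \<Rightarrow> nat" where "strict_mono s" "\<forall>n. s n \<in> {n. e \<le> dist (X n) L}"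
    using infinite_enumerate by blast
  then show ?thesis using e(1) by (intro that[of e s]) auto
qed

lemma tendsto_subseq:
  "(X \<longlonglongrightarrow> L) \<Longrightarrow> strict_mono r \<Longrightarrow> (\<lambda>n. X (r n)) \<longlonglongrightarrow> L"
  using LIMSEQ_subseq_LIMSEQ[of X L r] by (simp add: o_def)

text \<open>
  The additional property concerns iterated limits: a weakly convergent sequence of limits of
  sequences from a precompact set has a convergent subsequence. It is proved for convergence of
  order \<open>\<xi>\<close> below.
\<close>

locale diagonal_convergence_mode = weak_convergence_mode conv
  for conv :: "(nat \<Rightarrow> 'a::real_normed_vector) \<Rightarrow> 'a \<Rightarrow> bool" +
  assumes conv_diagonal: "\<lbrakk>seq_precompact_for K; \<And>n k. x n k \<in> K; \<And>n. conv (x n) (y n);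
      weak_limit y l\<rbrakk> \<Longrightarrow> \<exists>r. strict_mono r \<and> conv (y \<circ> r) l"
begin

definition seq_closure :: "'a set \<Rightarrow> 'a set" where
  "seq_closure K = {l. \<exists>x. range x \<subseteq> K \<and> conv x l}"

text \<open>
  Let \<open>x n k\<close> converge to \<open>y n\<close> as \<open>k \<rightarrow> \<infinity>\<close>, and let the functionals \<open>g i\<close> separate the weak limits
  of sequences of terms \<open>x n k\<close>. A diagonal sequence \<open>z n = x n k\<close>, with \<open>k\<close> depending on \<open>n\<close>, that is
  asymptotic to \<open>y\<close> under every \<open>g i\<close> has a subsequence converging to some \<open>l\<close>. For a further functional
  \<open>f\<close>, a second diagonal sequence \<open>w\<close> can be made asymptotic to \<open>y\<close> under \<open>f\<close> as well. Its subsequential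
  limits agree with \<open>l\<close> under every \<open>g i\<close>, hence equal \<open>l\<close>, and so \<open>f\<close> tends to \<open>f l\<close> along \<open>y\<close>.
\<close>

lemma seq_closure_weak_subseq:
  assumes K: "seq_precompact_for K" and y: "range (y :: nat \<Rightarrow> _) \<subseteq> seq_closure K"
  shows "\<exists>l\<in>seq_closure K. \<exists>r. strict_mono r \<and> weak_limit (y \<circ> r) l"
proof -
  have "\<forall>n. \<exists>x. range x \<subseteq> K \<and> conv x (y n)"
    using y by (auto simp: seq_closure_def)
  from choice[OF this] obtain x where x: "\<forall>n. range (x n) \<subseteq> K \<and> conv (x n) (y n)" ..
  then have xK: "x n k \<in> K" and x_conv: "conv (x n) (y n)" for n k by auto
  define c where "c i = (case prod_decode i of (n, k) \<Rightarrow> x n k)" for i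
  have xc: "x n k \<in> range c" for n k
    using rangeI[of c "prod_encode (n, k)"] by (simp add: c_def)
  from countable_separating_functionals[of c]
  obtain g :: "nat \<Rightarrow> 'a \<Rightarrow> real" where g': "\<forall>i. g i \<in> dual_ball" and
    g_sep: "\<forall>x x' l l'. weak_limit x l \<and> weak_limit x' l' \<and> range x \<subseteq> range c \<and> range x' \<subseteq> range c \<and>
      (\<forall>i. g i l = g i l') \<longrightarrow> l = l'"
    by (elim exE conjE)
  have g: "g i \<in> dual_ball" for i using g' ..
  have diagonal: "\<exists>z. (\<forall>n. z n \<in> range (x n)) \<and> (\<lambda>n. f (z n) - f (y n)) \<longlonglongrightarrow> 0 \<and>
      (\<forall>i. (\<lambda>n. g i (z n) - g i (y n)) \<longlonglongrightarrow> 0)" if f: "f \<in> dual_ball" for f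
  proof -
    have "\<exists>k. \<forall>h\<in>insert f (g ` {..n}). \<bar>h (x n k) - h (y n)\<bar> < 1 / real (Suc n)" for n
    proof -
      have "\<forall>\<^sub>F k in sequentially. \<bar>h (x n k) - h (y n)\<bar> < 1 / real (Suc n)" if "h \<in> dual_ball" for h
        using tendstoD[OF weak_limitD[OF conv_weak_limit[OF x_conv[of n]] that], of "1 / real (Suc n)"]
        by (simp add: dist_real_def)
      then have "\<forall>\<^sub>F k in sequentially. \<forall>h\<in>insert f (g ` {..n}). \<bar>h (x n k) - h (y n)\<bar> < 1 / real (Suc n)"
        using f g by (intro eventually_ball_finite) auto
      then show ?thesis using eventually_happens trivial_limit_sequentially by blast
    qed
    then have "\<forall>n. \<exists>k. \<forall>h\<in>insert f (g ` {..n}). \<bar>h (x n k) - h (y n)\<bar> < 1 / real (Suc n)" ..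
    from choice[OF this] obtain \<kappa>
      where \<kappa>: "\<forall>n. \<forall>h\<in>insert f (g ` {..n}). \<bar>h (x n (\<kappa> n)) - h (y n)\<bar> < 1 / real (Suc n)" ..
    have lim: "(\<lambda>n. h (x n (\<kappa> n)) - h (y n)) \<longlonglongrightarrow> 0" if "\<And>n. N \<le> n \<Longrightarrow> h \<in> insert f (g ` {..n})" for h N
    proof (rule Lim_null_comparison[OF _ LIMSEQ_inverse_real_of_nat[unfolded inverse_eq_divide]])
      show "\<forall>\<^sub>F n in sequentially. norm (h (x n (\<kappa> n)) - h (y n)) \<le> 1 / real (Suc n)"
        unfolding eventually_sequentially
      proof (intro exI[of _ N] allI impI)
        fix n assume "N \<le> n"
        from bspec[OF spec[OF \<kappa>] that[OF this]]
        show "norm (h (x n (\<kappa> n)) - h (y n)) \<le> 1 / real (Suc n)" by (simp add: less_imp_le)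
      qed
    qed
    show ?thesis
    proof (intro exI[of _ "\<lambda>n. x n (\<kappa> n)"] conjI allI)
      show "(\<lambda>n. f (x n (\<kappa> n)) - f (y n)) \<longlonglongrightarrow> 0" by (rule lim[of 0]) simp
      show "(\<lambda>n. g i (x n (\<kappa> n)) - g i (y n)) \<longlonglongrightarrow> 0" for i by (rule lim[of i]) auto
    qed simp
  qed
  have in_K: "range z \<subseteq> K" if "\<forall>n. z n \<in> range (x n)" for z
  proof (rule image_subsetI)
    show "z n \<in> K" for n using that[THEN spec, of n] xK by auto
  qed
  have in_c: "z n \<in> range c" if "\<forall>n. z n \<in> range (x n)" for z n
  proof -
    from spec[OF that, of n] obtain k where "z n = x n k" by (elim rangeE)
    then show ?thesis using xc by simp
  qed
  from diagonal[OF g[of 0]] obtain z where z: "\<forall>n. z n \<in> range (x n)"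
    and gz: "\<forall>i. (\<lambda>n. g i (z n) - g i (y n)) \<longlonglongrightarrow> 0"
    by (elim exE conjE)
  obtain l r where r: "strict_mono r" and l: "conv (z \<circ> r) l"
    using K in_K[OF z] unfolding seq_precompact_for_def by blast
  note l_weak = conv_weak_limit[OF l]
  have gy: "(\<lambda>n. g i (y (r n))) \<longlonglongrightarrow> g i l" for i
    using tendsto_diff[OF weak_limitD[OF l_weak g[of i]] tendsto_subseq[OF gz[THEN spec, of i] r]] by simp
  have "weak_limit (y \<circ> r) l"
    unfolding weak_limit_def
  proof (rule ballI, rule ccontr)
    fix f :: "'a \<Rightarrow> real" assume f: "f \<in> dual_ball" and nlim: "\<not> (\<lambda>n. f ((y \<circ> r) n)) \<longlonglongrightarrow> f l"
    from nlim obtain e and s :: "nat \<Rightarrow> nat"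
      where e: "0 < e" "strict_mono s" "\<forall>n. e \<le> dist (f ((y \<circ> r) (s n))) (f l)"
      by (rule not_tendsto_subseq)
    obtain w where w: "\<forall>n. w n \<in> range (x n)" and fw: "(\<lambda>n. f (w n) - f (y n)) \<longlonglongrightarrow> 0"
      and gw: "\<forall>i. (\<lambda>n. g i (w n) - g i (y n)) \<longlonglongrightarrow> 0"
      using diagonal[OF f] by (elim exE conjE)
    have "range (w \<circ> (r \<circ> s)) \<subseteq> K" using in_K[OF w] by auto
    then obtain l' s' where s': "strict_mono s'" and l': "conv (w \<circ> (r \<circ> s) \<circ> s') l'"
      using K unfolding seq_precompact_for_def by blast
    define t where "t n = s (s' n)" for n
    have t: "strict_mono t" using e(2) s' by (simp add: t_def strict_mono_def)
    then have rt: "strict_mono (\<lambda>n. r (t n))" using r by (simp add: strict_mono_def)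
    have l': "weak_limit (\<lambda>n. w (r (t n))) l'"
      using conv_weak_limit[OF l'] by (simp add: o_def t_def)
    have "g i l = g i l'" for i
    proof -
      have "(\<lambda>n. g i (w (r (t n)))) \<longlonglongrightarrow> g i l"
        using tendsto_add[OF tendsto_subseq[OF gw[THEN spec, of i] rt] tendsto_subseq[OF gy[of i] t]] by simp
      then show ?thesis using weak_limitD[OF l' g] LIMSEQ_unique by blast
    qed
    then have "l = l'"
      using l_weak l' in_c[OF z] in_c[OF w]
      by (intro g_sep[rule_format, of "z \<circ> r" l "\<lambda>n. w (r (t n))" l']) auto
    then have "(\<lambda>n. f (y (r (t n)))) \<longlonglongrightarrow> f l"
      using tendsto_diff[OF weak_limitD[OF l' f] tendsto_subseq[OF fw rt]] by simp
    then obtain n where "dist (f (y (r (t n)))) (f l) < e"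
      using tendstoD[OF _ e(1)] eventually_happens trivial_limit_sequentially by blast
    then show False using e(3)[THEN spec, of "s' n"] by (simp add: t_def)
  qed
  moreover have "l \<in> seq_closure K"
    unfolding seq_closure_def using l in_K[OF z] by (auto intro!: exI[of _ "z \<circ> r"])
  ultimately show ?thesis using r by blast
qed

lemma seq_compact_seq_closure:
  assumes K: "seq_precompact_for K"
  shows "seq_compact_for (seq_closure K)"
  unfolding seq_compact_for_def
proof (intro allI impI)
  fix y :: "nat \<Rightarrow> 'a" assume y: "range y \<subseteq> seq_closure K"
  obtain l r where l: "l \<in> seq_closure K" and r: "strict_mono r" "weak_limit (y \<circ> r) l"
    using seq_closure_weak_subseq[OF K y] by blast
  have "\<forall>n. \<exists>x. range x \<subseteq> K \<and> conv x ((y \<circ> r) n)"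
    using y by (auto simp: seq_closure_def)
  from choice[OF this] obtain x where x: "\<forall>n. range (x n) \<subseteq> K \<and> conv (x n) ((y \<circ> r) n)" ..
  have "\<exists>s. strict_mono s \<and> conv ((y \<circ> r) \<circ> s) l"
    using x by (intro conv_diagonal[OF K, of x]) (auto intro: r(2))
  then obtain s where s: "strict_mono s" "conv ((y \<circ> r) \<circ> s) l" by blast
  then show "\<exists>l\<in>seq_closure K. \<exists>r. strict_mono r \<and> conv (y \<circ> r) l"
    using l strict_mono_o[OF r(1) s(1)] by (metis comp_assoc)
qed

text \<open>
  For a precompact set, a single passage to limits of sequences already gives a closed set.
\<close>

theorem closure_of_seq_precompact:
  assumes K: "seq_precompact_for K"
  shows "seq_topology closure_of K = seq_closure K"
proof
  have "closedin seq_topology (seq_closure K)"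
    unfolding closedin_seq_topology
  proof (intro allI impI, elim conjE)
    fix y l assume "\<forall>n. y n \<in> seq_closure K" and y: "conv y l"
    then obtain l' r where "l' \<in> seq_closure K" "strict_mono r" "conv (y \<circ> r) l'"
      using seq_compact_seq_closure[OF K] unfolding seq_compact_for_def by blast
    then show "l \<in> seq_closure K" using conv_subseq_unique[OF y] by blast
  qed
  moreover have "K \<subseteq> seq_closure K"
  proof
    fix a assume "a \<in> K"
    then show "a \<in> seq_closure K"
      unfolding seq_closure_def using conv_const[of a] by (auto intro!: exI[of _ "\<lambda>_. a"])
  qed
  ultimately show "seq_topology closure_of K \<subseteq> seq_closure K"
    by (intro closure_of_minimal)
  show "seq_closure K \<subseteq> seq_topology closure_of K"
  proof
    fix l assume "l \<in> seq_closure K"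
    then obtain x where x: "range x \<subseteq> K" "conv x l" by (auto simp: seq_closure_def)
    have "K \<subseteq> seq_topology closure_of K" by (simp add: closure_of_subset)
    then have "\<forall>n. x n \<in> seq_topology closure_of K" using x(1) by auto
    moreover have "closedin seq_topology (seq_topology closure_of K)" by simp
    ultimately show "l \<in> seq_topology closure_of K"
      using x(2) unfolding closedin_seq_topology by blast
  qed
qed

theorem compactin_closure_of_iff:
  "compactin seq_topology (seq_topology closure_of K) \<longleftrightarrow> seq_precompact_for K"
proof
  assume "seq_precompact_for K"
  then show "compactin seq_topology (seq_topology closure_of K)"
    by (simp add: closure_of_seq_precompact seq_compact_seq_closure compactin_seq_topology_iff)
next
  assume "compactin seq_topology (seq_topology closure_of K)"
  then have "seq_compact_for (seq_topology closure_of K)"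
    by (simp add: compactin_seq_topology_iff)
  moreover have "K \<subseteq> seq_topology closure_of K" by (simp add: closure_of_subset)
  ultimately show "seq_precompact_for K"
    unfolding seq_compact_for_def seq_precompact_for_def by (meson order_trans)
qed

end


section \<open>Real and complex scalars\<close>

text \<open>
  The standard choices are \<open>\<rho> = id\<close>, \<open>J = 1\<close> for the real field and \<open>\<rho> = Re\<close>, \<open>J = \<i>\<close> for the complex
  field, where \<open>Im z = - Re (\<i> * z)\<close>. They allow both fields to be treated at once.
\<close>

definition scalar_coordinates :: "('k::real_or_complex \<Rightarrow> real) \<Rightarrow> 'k \<Rightarrow> bool" where
  "scalar_coordinates \<rho> J \<longleftrightarrow>
     linear \<rho> \<and> \<rho> 1 = 1 \<and> norm J = 1 \<and>
     (\<forall>z. \<bar>\<rho> z\<bar> \<le> norm z \<and> norm z \<le> \<bar>\<rho> z\<bar> + \<bar>\<rho> (J * z)\<bar>) \<and>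
     (J = 1 \<and> (\<forall>z. z = of_real (\<rho> z)) \<or>
      J * J = - 1 \<and> (\<forall>z. z = of_real (\<rho> z) - of_real (\<rho> (J * z)) * J))"

lemma scalar_coordinates_exist: "\<exists>(\<rho> :: 'k::real_or_complex \<Rightarrow> real) J. scalar_coordinates \<rho> J"
proof (cases "\<forall>z::'k. \<exists>a. z = a *\<^sub>R 1")
  case True
  then have "\<forall>z::'k. \<exists>a. z = of_real a" by (simp add: of_real_def)
  from choice[OF this] obtain \<rho> :: "'k \<Rightarrow> real" where \<rho>: "\<forall>z. z = of_real (\<rho> z)" ..
  then have eq: "of_real (\<rho> z) = z" for z by simp
  have "linear \<rho>"
  proof (rule linearI)
    show "\<rho> (x + y) = \<rho> x + \<rho> y" for x y
      by (rule of_real_eq_iff[where 'a = 'k, THEN iffD1]) (simp add: eq)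
    show "\<rho> (r *\<^sub>R x) = r *\<^sub>R \<rho> x" for r x
      by (rule of_real_eq_iff[where 'a = 'k, THEN iffD1]) (simp add: eq scaleR_conv_of_real)
  qed
  moreover have "\<rho> 1 = 1"
    by (rule of_real_eq_iff[where 'a = 'k, THEN iffD1]) (simp add: eq)
  moreover have "\<bar>\<rho> z\<bar> = norm z" for z
    using norm_of_real[of "\<rho> z", where 'a = 'k] by (simp add: eq)
  ultimately have "scalar_coordinates \<rho> 1"
    using \<rho> by (simp add: scalar_coordinates_def)
  then show ?thesis by blast
next
  case False
  then obtain i :: 'k where i: "i * i = - 1" and span: "\<forall>z. \<exists>p. z = fst p *\<^sub>R 1 + snd p *\<^sub>R i"
    and norm: "\<And>a b. norm (a *\<^sub>R 1 + b *\<^sub>R i) = sqrt (a\<^sup>2 + b\<^sup>2)"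
    using real_or_complex[where 'a = 'k] by auto
  from choice[OF span] obtain p where p: "\<forall>z. z = fst (p z) *\<^sub>R 1 + snd (p z) *\<^sub>R i" ..
  define \<rho> \<sigma> where "\<rho> z = fst (p z)" and "\<sigma> z = snd (p z)" for z
  have eq: "z = \<rho> z *\<^sub>R 1 + \<sigma> z *\<^sub>R i" for z
    unfolding \<rho>_def \<sigma>_def using p by (rule spec)
  have unique: "\<rho> z = a \<and> \<sigma> z = b" if z: "z = a *\<^sub>R 1 + b *\<^sub>R i" for z a b
  proof -
    have "(\<rho> z - a) *\<^sub>R 1 + (\<sigma> z - b) *\<^sub>R i = (\<rho> z *\<^sub>R 1 + \<sigma> z *\<^sub>R i) - (a *\<^sub>R 1 + b *\<^sub>R i)"
      by (simp add: scaleR_left_diff_distrib)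
    also have "\<dots> = 0" using eq[of z] z by simp
    finally have "sqrt ((\<rho> z - a)\<^sup>2 + (\<sigma> z - b)\<^sup>2) = 0"
      using norm[of "\<rho> z - a" "\<sigma> z - b"] by simp
    then show ?thesis by (simp add: sum_power2_eq_zero_iff)
  qed
  have mult_i: "\<rho> (i * z) = - \<sigma> z" for z
  proof -
    have "i * z = i * (\<rho> z *\<^sub>R 1 + \<sigma> z *\<^sub>R i)" using eq[of z] by simp
    also have "\<dots> = (- \<sigma> z) *\<^sub>R 1 + \<rho> z *\<^sub>R i"
      by (simp add: distrib_left i)
    finally show ?thesis using unique by blast
  qed
  have norm_z: "norm z = sqrt ((\<rho> z)\<^sup>2 + (\<sigma> z)\<^sup>2)" for z
    using norm[of "\<rho> z" "\<sigma> z"] eq[of z] by simp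
  have "scalar_coordinates \<rho> i"
    unfolding scalar_coordinates_def
  proof (intro conjI allI)
    show "linear \<rho>"
    proof (rule linearI)
      fix x y :: 'k and r :: real
      have "x + y = (\<rho> x *\<^sub>R 1 + \<sigma> x *\<^sub>R i) + (\<rho> y *\<^sub>R 1 + \<sigma> y *\<^sub>R i)"
        using eq[of x] eq[of y] by simp
      then have "x + y = (\<rho> x + \<rho> y) *\<^sub>R 1 + (\<sigma> x + \<sigma> y) *\<^sub>R i"
        by (simp add: algebra_simps)
      then show "\<rho> (x + y) = \<rho> x + \<rho> y" using unique by blast
      have "r *\<^sub>R x = r *\<^sub>R (\<rho> x *\<^sub>R 1 + \<sigma> x *\<^sub>R i)"
        using eq[of x] by simp
      then have "r *\<^sub>R x = (r * \<rho> x) *\<^sub>R 1 + (r * \<sigma> x) *\<^sub>R i"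
        by (simp add: scaleR_right_distrib)
      then show "\<rho> (r *\<^sub>R x) = r *\<^sub>R \<rho> x" using unique by fastforce
    qed
    show "\<rho> 1 = 1" using unique[of 1 1 0] by simp
    show "norm i = 1" using norm[of 0 1] by simp
    show "\<bar>\<rho> z\<bar> \<le> norm z" for z
      unfolding norm_z by (rule real_sqrt_ge_abs1)
    show "norm z \<le> \<bar>\<rho> z\<bar> + \<bar>\<rho> (i * z)\<bar>" for z
      unfolding norm_z mult_i by (simp add: sqrt_sum_squares_le_sum_abs)
    have "z = of_real (\<rho> z) - of_real (\<rho> (i * z)) * i" for z
      unfolding mult_i using eq[of z] by (simp add: scaleR_conv_of_real)
    then show "i = 1 \<and> (\<forall>z. z = of_real (\<rho> z)) \<or>
        i * i = - 1 \<and> (\<forall>z. z = of_real (\<rho> z) - of_real (\<rho> (i * z)) * i)"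
      using i by blast
  qed
  then show ?thesis by blast
qed

context banach_space_over
begin

lemma linear_smul: "linear (smul c)"
proof (rule linearI)
  show "smul c (x + y) = smul c x + smul c y" for x y by (rule scale_right_distrib)
  show "smul c (r *\<^sub>R x) = r *\<^sub>R smul c x" for r x
    by (simp add: smul_of_real[symmetric] scale_left_commute)
qed

lemma dual_ball_smul:
  assumes f: "f \<in> dual_ball" and c: "norm c = 1"
  shows "(\<lambda>x. f (smul c x)) \<in> dual_ball"
  using linear_compose[OF linear_smul dual_ballD(1)[OF f], of c] dual_ballD(2)[OF f] c
  by (simp add: dual_ball_def o_def) (metis mult_1 norm_smul)

text \<open>
  Over the complex field a real functional \<open>u\<close> is the real part of \<open>x \<mapsto> u x - \<i> u (\<i> x)\<close>.
\<close>

lemma dual_ball_real_part: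
  assumes \<rho>: "scalar_coordinates \<rho> J" and u: "u \<in> dual_ball"
  obtains F where "Vector_Spaces.linear smul (*) F" "continuous_on UNIV F" "\<forall>x. \<rho> (F x) = u x"
proof -
  note lin_u = dual_ballD(1)[OF u]
  have lin_\<rho>: "linear \<rho>" and \<rho>1: "\<rho> 1 = 1" using \<rho> by (auto simp: scalar_coordinates_def)
  have \<rho>_real: "\<rho> (of_real a * z) = a * \<rho> z" for a z
    using linear_scale[OF lin_\<rho>, of a z] by (simp add: scaleR_conv_of_real)
  have \<rho>_of_real: "\<rho> (of_real a) = a" for a using \<rho>_real[of a 1] \<rho>1 by simp
  have u_real: "u (smul (of_real a) x) = a * u x" for a x
    using linear_scale[OF lin_u, of a x] by (simp add: smul_of_real)
  have bl_u: "bounded_linear u"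
    using dual_ballD(2)[OF u]
    by (intro bounded_linear_intro[of u 1] linear_add[OF lin_u] linear_scale[OF lin_u]) auto
  have bl_J: "bounded_linear (\<lambda>x. u (smul J x))"
    using linear_smul \<rho> by (intro bounded_linear_compose[OF bl_u] bounded_linear_intro[of _ 1])
      (auto simp: linear_add linear_scale norm_smul scalar_coordinates_def)
  have vs: "vector_space smul" "vector_space ((*) :: 'k \<Rightarrow> 'k \<Rightarrow> 'k)"
    by (rule vector_space_axioms, unfold_locales) (auto simp: algebra_simps)
  consider (real) "J = 1" "\<And>z. z = of_real (\<rho> z)"
    | (complex) "J * J = - 1" "\<And>z. z = of_real (\<rho> z) - of_real (\<rho> (J * z)) * J"
    using \<rho> unfolding scalar_coordinates_def by blast
  then show ?thesis
  proof cases
    case real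
    define F :: "'a \<Rightarrow> 'k" where "F x = of_real (u x)" for x
    have "F (smul c x) = c * F x" for c x
      using u_real[of "\<rho> c" x] real(2)[of c] by (simp add: F_def)
    then have "Vector_Spaces.linear smul (*) F"
      unfolding Vector_Spaces.linear_iff using vs by (simp add: F_def linear_add[OF lin_u])
    moreover have "continuous_on UNIV F"
      unfolding F_def by (intro continuous_on_of_real linear_continuous_on bl_u)
    moreover have "\<forall>x. \<rho> (F x) = u x" by (simp add: F_def \<rho>_of_real)
    ultimately show ?thesis by (rule that)
  next
    case complex
    define F :: "'a \<Rightarrow> 'k" where "F x = of_real (u x) - of_real (u (smul J x)) * J" for x
    have "\<rho> J = 0"
      using complex(2)[of J] \<rho>1 linear_neg[OF lin_\<rho>, of 1] by (simp add: complex(1))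
    have "F (smul c x) = c * F x" for c x
    proof -
      define a b where "a = \<rho> c" and "b = - \<rho> (J * c)"
      have c: "c = of_real a + of_real b * J"
        using complex(2)[of c] by (simp add: a_def b_def)
      have u_c: "u (smul c x) = a * u x + b * u (smul J x)"
        by (simp add: c scale_left_distrib linear_add[OF lin_u] u_real flip: scale_scale)
      have "smul J (smul c x) = smul (of_real a) (smul J x) + smul (of_real b) (- x)"
      proof -
        have "J * c = of_real a * J + of_real b * (J * J)" by (simp add: c algebra_simps)
        then show ?thesis
          by (simp add: complex(1) scale_left_distrib scale_left_diff_distrib)
      qed
      then have u_Jc: "u (smul J (smul c x)) = a * u (smul J x) - b * u x"
        by (simp add: linear_add[OF lin_u] u_real linear_neg[OF lin_u] del: scale_minus_right scale_scale)
      have J2: "of_real b * J * (of_real (u (smul J x)) * J) = - of_real (b * u (smul J x))"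
      proof -
        have "of_real b * J * (of_real (u (smul J x)) * J) = of_real (b * u (smul J x)) * (J * J)"
          by (simp add: algebra_simps)
        then show ?thesis by (simp add: complex(1))
      qed
      have "F (smul c x) = of_real (a * u x + b * u (smul J x)) - of_real (a * u (smul J x) - b * u x) * J"
        by (simp only: F_def u_c u_Jc)
      also have "\<dots> = of_real a * of_real (u x) - of_real a * (of_real (u (smul J x)) * J)
          + of_real b * J * of_real (u x) - of_real b * J * (of_real (u (smul J x)) * J)"
        unfolding J2 by (simp add: algebra_simps)
      also have "\<dots> = (of_real a + of_real b * J) * F x"
        by (simp add: F_def algebra_simps)
      finally show ?thesis by (simp only: c[symmetric])
    qed
    then have "Vector_Spaces.linear smul (*) F"
      unfolding Vector_Spaces.linear_iff using vs
      by (simp add: F_def linear_add[OF lin_u] linear_add[OF linear_smul] algebra_simps)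
    moreover have "continuous_on UNIV F"
      unfolding F_def by (intro continuous_intros continuous_on_of_real linear_continuous_on bl_u bl_J)
    moreover have "\<forall>x. \<rho> (F x) = u x"
      using \<open>\<rho> J = 0\<close> by (simp add: F_def \<rho>_of_real \<rho>_real linear_diff[OF lin_\<rho>])
    ultimately show ?thesis by (rule that)
  qed
qed

lemma continuous_linear_scaled_dual_ball:
  assumes lin: "linear (u :: 'a \<Rightarrow> real)" and cont: "continuous_on UNIV u"
  obtains M where "0 < M" "(\<lambda>x. u x / M) \<in> dual_ball"
proof -
  have "isCont u 0" using cont by (simp add: continuous_on_eq_continuous_at)
  then obtain d where d: "0 < d" "\<And>x. norm x < d \<Longrightarrow> \<bar>u x\<bar> < 1"
    unfolding continuous_at_eps_delta using linear_0[OF lin]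
    by (metis dist_0_norm dist_commute dist_real_def diff_zero zero_less_one)
  have "\<bar>u x\<bar> \<le> 2 / d * norm x" for x
  proof (cases "x = 0")
    case False
    define t where "t = d / (2 * norm x)"
    have t: "0 < t" using False d(1) by (simp add: t_def)
    have "\<bar>u (t *\<^sub>R x)\<bar> < 1"
      using False d(1) by (intro d(2)) (simp add: t_def)
    then have "t * \<bar>u x\<bar> < 1" using t by (simp add: linear_scale[OF lin] abs_mult)
    then have "\<bar>u x\<bar> < 1 / t" using t by (simp add: field_simps)
    then show ?thesis using False by (simp add: t_def field_simps)
  qed (simp add: linear_0[OF lin])
  then have "(\<lambda>x. u x / (2 / d)) \<in> dual_ball"
    using d(1) linear_compose_scale_right[OF lin, of "d / 2"]
    by (auto simp: dual_ball_def abs_mult field_simps)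
  then show ?thesis using d(1) by (intro that[of "2 / d"]) auto
qed

theorem weakly_convergent_to_iff: "weakly_convergent_to smul x l \<longleftrightarrow> weak_limit x l"
proof -
  obtain \<rho> :: "'k \<Rightarrow> real" and J where \<rho>: "scalar_coordinates \<rho> J"
    using scalar_coordinates_exist by blast
  then have lin_\<rho>: "linear \<rho>" and \<rho>_le: "\<And>z. \<bar>\<rho> z\<bar> \<le> norm z"
    and norm_le: "\<And>z. norm z \<le> \<bar>\<rho> z\<bar> + \<bar>\<rho> (J * z)\<bar>"
    by (auto simp: scalar_coordinates_def)
  have bl_\<rho>: "bounded_linear \<rho>"
    using \<rho>_le by (intro bounded_linear_intro[of _ 1] linear_add[OF lin_\<rho>] linear_scale[OF lin_\<rho>]) auto
  show ?thesis
  proof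
    assume w: "weakly_convergent_to smul x l"
    show "weak_limit x l"
      unfolding weak_limit_def
    proof
      fix u :: "'a \<Rightarrow> real" assume "u \<in> dual_ball"
      then obtain F where F: "Vector_Spaces.linear smul (*) F" "continuous_on UNIV F" "\<forall>x. \<rho> (F x) = u x"
        by (rule dual_ball_real_part[OF \<rho>])
      then have "(\<lambda>n. F (x n)) \<longlonglongrightarrow> F l" using w by (auto simp: weakly_convergent_to_def)
      then have "(\<lambda>n. \<rho> (F (x n))) \<longlonglongrightarrow> \<rho> (F l)" by (rule bounded_linear.tendsto[OF bl_\<rho>])
      then show "(\<lambda>n. u (x n)) \<longlonglongrightarrow> u l" using F(3) by simp
    qed
  next
    assume w: "weak_limit x l"
    show "weakly_convergent_to smul x l"
      unfolding weakly_convergent_to_def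
    proof (intro allI impI, elim conjE)
      fix F :: "'a \<Rightarrow> 'k" assume F: "Vector_Spaces.linear smul (*) F" and cont: "continuous_on UNIV F"
      interpret F: Vector_Spaces.linear smul "(*)" F by (rule F)
      have conv: "(\<lambda>n. \<rho> (c * F (x n))) \<longlonglongrightarrow> \<rho> (c * F l)" for c
      proof -
        define u where "u y = \<rho> (c * F y)" for y
        have "linear u"
        proof (rule linearI)
          show "u (y + z) = u y + u z" for y z
            by (simp add: u_def F.add distrib_left linear_add[OF lin_\<rho>])
          show "u (r *\<^sub>R y) = r *\<^sub>R u y" for r y
          proof -
            have "c * F (r *\<^sub>R y) = r *\<^sub>R (c * F y)"
              by (simp add: smul_of_real[symmetric] F.scale scaleR_conv_of_real)
            then show ?thesis by (simp add: u_def linear_scale[OF lin_\<rho>])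
          qed
        qed
        moreover have "continuous_on UNIV u"
          unfolding u_def by (intro bounded_linear.continuous_on[OF bl_\<rho>] continuous_intros cont)
        ultimately obtain M where M: "0 < M" "(\<lambda>x. u x / M) \<in> dual_ball"
          by (rule continuous_linear_scaled_dual_ball)
        have "(\<lambda>n. M * (u (x n) / M)) \<longlonglongrightarrow> M * (u l / M)"
          by (rule tendsto_mult_left[OF weak_limitD[OF w M(2)]])
        then show ?thesis using M(1) by (simp add: u_def)
      qed
      have "(\<lambda>n. F (x n) - F l) \<longlonglongrightarrow> 0"
      proof (rule Lim_null_comparison)
        show "\<forall>\<^sub>F n in sequentially. norm (F (x n) - F l) \<le>
            \<bar>\<rho> (1 * F (x n)) - \<rho> (1 * F l)\<bar> + \<bar>\<rho> (J * F (x n)) - \<rho> (J * F l)\<bar>"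
          using norm_le[of "F (x _) - F l"] by (simp add: right_diff_distrib linear_diff[OF lin_\<rho>])
        show "(\<lambda>n. \<bar>\<rho> (1 * F (x n)) - \<rho> (1 * F l)\<bar> + \<bar>\<rho> (J * F (x n)) - \<rho> (J * F l)\<bar>) \<longlonglongrightarrow> 0"
          by (intro tendsto_add_zero tendsto_rabs_zero LIM_zero conv)
      qed
      then show "(\<lambda>n. F (x n)) \<longlonglongrightarrow> F l" by (rule LIM_zero_cancel)
    qed
  qed
qed

end


section \<open>Functionals attached to a family of finite sets\<close>

lemma ultrafilter_limit_dual_ball:
  assumes U: "ultrafilter U" and h: "\<And>i. h i \<in> dual_ball"
  obtains f where "f \<in> dual_ball" "\<forall>x. ((\<lambda>i. h i x) \<longlongrightarrow> f x) U"
proof -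
  have "U \<noteq> bot" using U by (simp add: ultrafilter_def)
  have "\<forall>x. \<exists>l. ((\<lambda>i. h i x) \<longlongrightarrow> l) U"
  proof
    fix x
    show "\<exists>l. ((\<lambda>i. h i x) \<longlongrightarrow> l) U"
      by (rule ultrafilter_bounded_convergent[OF U, of _ "norm x"]) (simp add: dual_ballD(2)[OF h])
  qed
  from choice[OF this] obtain f where f: "\<forall>x. ((\<lambda>i. h i x) \<longlongrightarrow> f x) U" ..
  then have lim: "((\<lambda>i. h i x) \<longlongrightarrow> f x) U" for x by blast
  have "f \<in> dual_ball"
  proof (rule dual_ballI)
    show "linear f"
    proof (rule linearI)
      fix x y and r :: real
      have "((\<lambda>i. h i (x + y)) \<longlongrightarrow> f x + f y) U"
        using tendsto_add[OF lim[of x] lim[of y]] by (simp add: linear_add[OF dual_ballD(1)[OF h]])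
      then show "f (x + y) = f x + f y" by (rule tendsto_unique[OF \<open>U \<noteq> bot\<close> lim])
      have "((\<lambda>i. h i (r *\<^sub>R x)) \<longlongrightarrow> r *\<^sub>R f x) U"
        using tendsto_scaleR[OF tendsto_const[of r] lim[of x]]
        by (simp add: linear_scale[OF dual_ballD(1)[OF h]])
      then show "f (r *\<^sub>R x) = r *\<^sub>R f x" by (rule tendsto_unique[OF \<open>U \<noteq> bot\<close> lim])
    qed
    show "f x \<le> norm x" for x
      by (rule tendsto_upperbound[OF lim _ \<open>U \<noteq> bot\<close>]) (simp add: dual_ballD(3)[OF h])
  qed
  then show ?thesis using f by (rule that)
qed

context banach_space_over
begin

text \<open>
  The \<open>\<ell>\<^sub>1\<close> lower estimate on \<open>F\<close> ensures that prescribing the same value \<open>c\<close> at all \<open>v n\<close>,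
  \<open>n \<in> F\<close>, is consistent with norm at most one.
\<close>

lemma interpolating_functional:
  assumes \<rho>: "scalar_coordinates \<rho> J" and c: "0 < c" and F: "finite F"
    and lower: "\<And>a. c * (\<Sum>n\<in>F. norm (a n)) \<le> norm (\<Sum>n\<in>F. smul (a n) (v n))"
  obtains f where "f \<in> dual_ball" "\<forall>n\<in>F. \<forall>\<mu>. f (smul \<mu> (v n)) = c * \<rho> \<mu>"
proof -
  have lin: "linear \<rho>" and \<rho>_le: "\<And>z. \<bar>\<rho> z\<bar> \<le> norm z" using \<rho> by (auto simp: scalar_coordinates_def)
  define G where "G = range (\<lambda>a. (\<Sum>n\<in>F. smul (a n) (v n), c * (\<Sum>n\<in>F. \<rho> (a n))))"
  have G: "(\<Sum>n\<in>F. smul (a n) (v n), c * (\<Sum>n\<in>F. \<rho> (a n))) \<in> G" for a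
    by (auto simp: G_def)
  obtain f where f: "f \<in> dual_ball" "\<And>x r. (x, r) \<in> G \<Longrightarrow> r \<le> f x"
  proof (rule mazur_orlicz[of G])
    show "(0, 0) \<in> G" using G[of "\<lambda>_. 0"] by (simp add: linear_0[OF lin])
  next
    fix x r y s assume "(x, r) \<in> G" "(y, s) \<in> G"
    then obtain a b where *: "x = (\<Sum>n\<in>F. smul (a n) (v n))" "r = c * (\<Sum>n\<in>F. \<rho> (a n))"
      "y = (\<Sum>n\<in>F. smul (b n) (v n))" "s = c * (\<Sum>n\<in>F. \<rho> (b n))" by (auto simp: G_def)
    show "(x + y, r + s) \<in> G"
      using G[of "\<lambda>n. a n + b n"]
      by (simp add: * scale_left_distrib linear_add[OF lin] sum.distrib distrib_left)
  next
    fix t :: real and x r assume "(x, r) \<in> G" "0 \<le> t"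
    then obtain a where *: "x = (\<Sum>n\<in>F. smul (a n) (v n))" "r = c * (\<Sum>n\<in>F. \<rho> (a n))"
      by (auto simp: G_def)
    have "\<rho> (of_real t * z) = t * \<rho> z" for z
      using linear_scale[OF lin, of t z] by (simp add: scaleR_conv_of_real)
    moreover have "smul (of_real t * z) y = t *\<^sub>R smul z y" for z y
      by (simp add: smul_of_real[symmetric])
    ultimately show "(t *\<^sub>R x, t * r) \<in> G"
      using G[of "\<lambda>n. of_real t * a n"]
      by (simp add: * scaleR_sum_right sum_distrib_left mult.left_commute)
  next
    fix x r assume "(x, r) \<in> G"
    then obtain a where *: "x = (\<Sum>n\<in>F. smul (a n) (v n))" "r = c * (\<Sum>n\<in>F. \<rho> (a n))"
      by (auto simp: G_def)
    have "\<rho> (a n) \<le> norm (a n)" for n using \<rho>_le[of "a n"] by simp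
    then have "r \<le> c * (\<Sum>n\<in>F. norm (a n))"
      unfolding * using c by (intro mult_left_mono sum_mono) auto
    also have "\<dots> \<le> norm x" unfolding * by (rule lower)
    finally show "r \<le> norm x" .
  qed (use that in blast)
  have le: "c * \<rho> \<mu> \<le> f (smul \<mu> (v n))" if n: "n \<in> F" for n \<mu>
  proof -
    let ?a = "\<lambda>k. if k = n then \<mu> else 0"
    have "(\<Sum>k\<in>F. smul (?a k) (v k)) = smul \<mu> (v n)"
      using sum.delta[OF F, of n "\<lambda>k. smul \<mu> (v k)"] n by (simp add: if_distrib[of "\<lambda>t. smul t _"] cong: if_cong)
    moreover have "(\<Sum>k\<in>F. \<rho> (?a k)) = \<rho> \<mu>"
      using sum.delta[OF F, of n "\<lambda>k. \<rho> \<mu>"] n by (simp add: if_distrib[of \<rho>] linear_0[OF lin] cong: if_cong)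
    ultimately show ?thesis using f(2)[OF G[of ?a]] by simp
  qed
  have "f (smul \<mu> (v n)) = c * \<rho> \<mu>" if "n \<in> F" for n \<mu>
    using le[OF that, of \<mu>] le[OF that, of "- \<mu>"]
    by (simp add: linear_neg[OF lin] linear_neg[OF dual_ballD(1)[OF f(1)]])
  then show ?thesis using f(1) that by blast
qed

text \<open>
  The sets in \<open>\<S>\<close> form a tree, \<open>insert n F\<close> with \<open>n\<close> above \<open>F\<close> being a child of \<open>F\<close>. To each \<open>F\<close> is
  attached a functional that interpolates the value \<open>c\<close> on \<open>F\<close> and is the limit along the ultrafilter of
  the functionals of the children, if almost all \<open>n\<close> yield a child; otherwise any interpolating
  functional will do. The recursion runs from the leaves to the root. It is well-founded: along an
  infinite branch the interpolating functionals would have a limit with value \<open>c\<close> at infinitely many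
  \<open>v n\<close>, although \<open>v\<close> is weakly null.
\<close>

lemma functional_tree:
  fixes \<S> :: "nat set set" and v :: "nat \<Rightarrow> 'a"
  assumes \<rho>: "scalar_coordinates \<rho> J" and c: "0 < c"
    and v: "weak_limit v 0"
    and fin: "\<And>F. F \<in> \<S> \<Longrightarrow> finite F"
    and lower: "\<And>F a. F \<in> \<S> \<Longrightarrow> c * (\<Sum>n\<in>F. norm (a n)) \<le> norm (\<Sum>n\<in>F. smul (a n) (v n))"
    and U: "ultrafilter U" "U \<le> sequentially"
  obtains h where "\<And>F. F \<in> \<S> \<Longrightarrow> h F \<in> dual_ball"
    "\<And>F n \<mu>. F \<in> \<S> \<Longrightarrow> n \<in> F \<Longrightarrow> h F (smul \<mu> (v n)) = c * \<rho> \<mu>"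
    "\<And>F x. F \<in> \<S> \<Longrightarrow> \<forall>\<^sub>F n in U. insert n F \<in> \<S> \<Longrightarrow> ((\<lambda>n. h (insert n F) x) \<longlongrightarrow> h F x) U"
proof -
  have bot: "U \<noteq> bot" using U by (simp add: ultrafilter_def)
  have ev_ge: "\<forall>\<^sub>F n in U. N \<le> n" for N
    using U(2) eventually_ge_at_top[of N] by (auto simp: le_filter_def)
  define R where "R = {(insert n F, F) |n F. insert n F \<in> \<S> \<and> (\<forall>m\<in>F. m < n)}"
  have "wf R"
    unfolding wf_iff_no_infinite_down_chain
  proof
    assume "\<exists>X. \<forall>i. (X (Suc i), X i) \<in> R"
    then obtain X where "\<forall>i. (X (Suc i), X i) \<in> R" ..
    then have "\<forall>i. \<exists>n. X (Suc i) = insert n (X i) \<and> insert n (X i) \<in> \<S> \<and> (\<forall>m\<in>X i. m < n)"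
      by (auto simp: R_def)
    from choice[OF this] obtain n
      where n: "\<forall>i. X (Suc i) = insert (n i) (X i) \<and> insert (n i) (X i) \<in> \<S> \<and> (\<forall>m\<in>X i. m < n i)" ..
    then have XS: "X (Suc i) \<in> \<S>" and n_new: "n i \<in> X (Suc i)" and n_gt: "\<And>m. m \<in> X i \<Longrightarrow> m < n i"
      and X_sub: "X i \<subseteq> X (Suc i)" for i
      by auto
    have mono: "strict_mono n"
      unfolding strict_mono_Suc_iff using n_gt n_new by blast
    have X_mono: "X i \<subseteq> X j" if "i \<le> j" for i j
      using X_sub that by (rule lift_Suc_mono_le)
    have "\<forall>i. \<exists>f. f \<in> dual_ball \<and> (\<forall>k\<in>X (Suc i). \<forall>\<mu>. f (smul \<mu> (v k)) = c * \<rho> \<mu>)"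
    proof
      fix i
      show "\<exists>f. f \<in> dual_ball \<and> (\<forall>k\<in>X (Suc i). \<forall>\<mu>. f (smul \<mu> (v k)) = c * \<rho> \<mu>)"
        by (rule interpolating_functional[OF \<rho> c fin[OF XS] lower[OF XS]]) blast
    qed
    from choice[OF this] obtain f
      where f: "\<forall>i. f i \<in> dual_ball \<and> (\<forall>k\<in>X (Suc i). \<forall>\<mu>. f i (smul \<mu> (v k)) = c * \<rho> \<mu>)" ..
    then have "f i \<in> dual_ball" for i by blast
    then obtain f' where f': "f' \<in> dual_ball" "\<forall>x. ((\<lambda>i. f i x) \<longlongrightarrow> f' x) U"
      by (rule ultrafilter_limit_dual_ball[OF U(1)])
    have "f' (v (n k)) = c" for k
    proof -
      have "f i (v (n k)) = c" if "k \<le> i" for i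
      proof -
        have "n k \<in> X (Suc i)" using n_new[of k] X_mono[of "Suc k" "Suc i"] that by auto
        then have "f i (smul 1 (v (n k))) = c * \<rho> 1" using f by blast
        then show ?thesis using \<rho> by (simp add: scalar_coordinates_def)
      qed
      then have "\<forall>\<^sub>F i in U. f i (v (n k)) = c"
        using ev_ge[of k] by (auto elim: eventually_mono)
      then have "((\<lambda>i. f i (v (n k))) \<longlongrightarrow> c) U" by (rule tendsto_eventually)
      then show ?thesis using tendsto_unique[OF bot f'(2)[THEN spec, of "v (n k)"]] by blast
    qed
    moreover have "(\<lambda>k. f' (v (n k))) \<longlonglongrightarrow> 0"
      using tendsto_subseq[OF weak_limitD[OF v f'(1)] mono] by (simp add: linear_0[OF dual_ballD(1)[OF f'(1)]])
    ultimately show False using c by (simp add: LIMSEQ_const_iff)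
  qed
  define P where "P h F f \<longleftrightarrow> (F \<in> \<S> \<longrightarrow> f \<in> dual_ball \<and> (\<forall>n\<in>F. \<forall>\<mu>. f (smul \<mu> (v n)) = c * \<rho> \<mu>) \<and>
      ((\<forall>\<^sub>F n in U. insert n F \<in> \<S>) \<longrightarrow> (\<forall>x. ((\<lambda>n. h (insert n F) x) \<longlongrightarrow> f x) U)))"
    for h :: "nat set \<Rightarrow> 'a \<Rightarrow> real" and F and f :: "'a \<Rightarrow> real"
  have ev_R: "\<forall>\<^sub>F n in U. (insert n F, F) \<in> R" if "F \<in> \<S>" "\<forall>\<^sub>F n in U. insert n F \<in> \<S>" for F
    using that(2) ev_ge[of "Suc (Max (insert 0 F))"]
  proof eventually_elim
    case (elim n)
    have "m < n" if "m \<in> F" for m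
    proof -
      have "m \<le> Max (insert 0 F)" using fin[OF \<open>F \<in> \<S>\<close>] that by (intro Max_ge) auto
      then show ?thesis using elim(2) by linarith
    qed
    then show ?case using elim(1) by (auto simp: R_def)
  qed
  have "\<exists>h. \<forall>F. P h F (h F)"
  proof (rule dependent_wf_choice[OF \<open>wf R\<close>])
    fix h h' :: "nat set \<Rightarrow> 'a \<Rightarrow> real" and F f
    assume agree: "\<And>z. (z, F) \<in> R \<Longrightarrow> h z = h' z"
    have "((\<lambda>n. h (insert n F) x) \<longlongrightarrow> f x) U \<longleftrightarrow> ((\<lambda>n. h' (insert n F) x) \<longlongrightarrow> f x) U"
      if "F \<in> \<S>" "\<forall>\<^sub>F n in U. insert n F \<in> \<S>" for x
    proof (rule tendsto_cong)
      show "\<forall>\<^sub>F n in U. h (insert n F) x = h' (insert n F) x"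
        using ev_R[OF that] by eventually_elim (simp add: agree)
    qed
    then show "P h F f = P h' F f" by (auto simp: P_def)
  next
    fix F and h :: "nat set \<Rightarrow> 'a \<Rightarrow> real"
    assume IH: "\<And>z. (z, F) \<in> R \<Longrightarrow> P h z (h z)"
    show "\<exists>f. P h F f"
    proof (cases "F \<in> \<S>")
      case F: True
      show ?thesis
      proof (cases "\<forall>\<^sub>F n in U. insert n F \<in> \<S>")
        case True
        note evR = ev_R[OF F True]
        \<comment> \<open>For the negligible set of \<open>n\<close> that yield no child, the zero functional serves as a value in the dual ball.\<close>
        define h' where "h' n = (if (insert n F, F) \<in> R then h (insert n F) else (\<lambda>_. 0))" for n
        have h: "h (insert n F) \<in> dual_ball"
          "\<And>m \<mu>. m \<in> F \<Longrightarrow> h (insert n F) (smul \<mu> (v m)) = c * \<rho> \<mu>" if "(insert n F, F) \<in> R" for n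
        proof -
          have "insert n F \<in> \<S>" using that by (force simp: R_def)
          then show "h (insert n F) \<in> dual_ball"
            "\<And>m \<mu>. m \<in> F \<Longrightarrow> h (insert n F) (smul \<mu> (v m)) = c * \<rho> \<mu>"
            using IH[OF that] by (auto simp: P_def)
        qed
        have "h' n \<in> dual_ball" for n
          using h by (auto simp: h'_def dual_ball_def linear_zero)
        then obtain f where f: "f \<in> dual_ball" "\<forall>x. ((\<lambda>n. h' n x) \<longlongrightarrow> f x) U"
          by (rule ultrafilter_limit_dual_ball[OF U(1)])
        have "((\<lambda>n. h (insert n F) x) \<longlongrightarrow> f x) U" for x
        proof (rule tendsto_cong[THEN iffD1, OF _ f(2)[THEN spec, of x]])
          show "\<forall>\<^sub>F n in U. h' n x = h (insert n F) x"
            using evR by eventually_elim (simp add: h'_def)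
        qed
        moreover have "f (smul \<mu> (v m)) = c * \<rho> \<mu>" if "m \<in> F" for m \<mu>
        proof -
          have "\<forall>\<^sub>F n in U. h' n (smul \<mu> (v m)) = c * \<rho> \<mu>"
            using evR by eventually_elim (simp add: h'_def h(2) that)
          then have "((\<lambda>n. h' n (smul \<mu> (v m))) \<longlongrightarrow> c * \<rho> \<mu>) U" by (rule tendsto_eventually)
          then show ?thesis using tendsto_unique[OF bot f(2)[THEN spec, of "smul \<mu> (v m)"]] by blast
        qed
        ultimately have "P h F f" using f(1) by (simp add: P_def)
        then show ?thesis by (intro exI[of _ f])
      next
        case False
        obtain f where "f \<in> dual_ball" "\<forall>n\<in>F. \<forall>\<mu>. f (smul \<mu> (v n)) = c * \<rho> \<mu>"
          by (rule interpolating_functional[OF \<rho> c fin[OF F] lower[OF F]])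
        then have "P h F f" using False unfolding P_def by blast
        then show ?thesis by (intro exI[of _ f])
      qed
    qed (simp add: P_def)
  qed
  then obtain h where h: "\<forall>F. P h F (h F)" ..
  show ?thesis
  proof (rule that[of h])
    fix F assume F: "F \<in> \<S>"
    note P = h[THEN spec, of F, unfolded P_def, THEN mp, OF F]
    show "h F \<in> dual_ball" using P by blast
    show "h F (smul \<mu> (v n)) = c * \<rho> \<mu>" if "n \<in> F" for n \<mu> using P that by blast
    show "((\<lambda>n. h (insert n F) x) \<longlongrightarrow> h F x) U" if "\<forall>\<^sub>F n in U. insert n F \<in> \<S>" for x
      using P that by blast
  qed
qed

end


section \<open>Diagonal sequences\<close>

context banach_space_over
begin

text \<open>
  Testing at the two scalars \<open>1\<close> and \<open>J\<close> controls all scalar multiples of \<open>y n\<close>, see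
  \<open>interpolation_on_multiples\<close>.
\<close>

definition interpolates_within ::
    "real \<Rightarrow> real \<Rightarrow> ('k \<Rightarrow> real) \<Rightarrow> 'k \<Rightarrow> 'b set \<Rightarrow> ('b \<Rightarrow> 'a) \<Rightarrow> 'b \<Rightarrow> ('a \<Rightarrow> real) \<Rightarrow> bool" where
  "interpolates_within \<epsilon> c \<rho> J F y n f \<longleftrightarrow>
     (\<forall>s\<in>{1, J}. \<bar>f (smul s (y n)) - (if n \<in> F then c * \<rho> s else 0)\<bar> < \<epsilon>)"

text \<open>
  The choice of \<open>n\<close> and then of \<open>k\<close> must keep the estimate for all sets \<open>F \<subseteq> insert n M\<close> and all points.
  At the old points, the functional of \<open>insert n F\<close> inherits the estimate from that of \<open>F\<close>, as it
  converges to it along the ultrafilter. At the new point, the functionals of sets \<open>F\<close> without \<open>n\<close>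
  are small at \<open>v n\<close> because \<open>v\<close> is weakly null, and those of sets with \<open>n\<close> have the right value at
  \<open>v n\<close>; both persist for \<open>w n k\<close> with large \<open>k\<close>. Only finitely many functionals are involved, and all
  inequalities are strict, so no loss accumulates in the iteration.
\<close>

lemma diagonal_selection_step:
  fixes \<S> :: "nat set set" and v :: "nat \<Rightarrow> 'a"
  assumes \<rho>: "scalar_coordinates \<rho> J" and \<epsilon>: "0 < \<epsilon>"
    and v: "weak_limit v 0" and w: "\<And>n. weak_limit (w n) (v n)"
    and down: "\<And>F F'. F \<in> \<S> \<Longrightarrow> F' \<subseteq> F \<Longrightarrow> F' \<in> \<S>"
    and U: "ultrafilter U" "U \<le> sequentially"
    and h: "\<And>F. F \<in> \<S> \<Longrightarrow> h F \<in> dual_ball"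
    and h_eq: "\<And>F n \<mu>. F \<in> \<S> \<Longrightarrow> n \<in> F \<Longrightarrow> h F (smul \<mu> (v n)) = c * \<rho> \<mu>"
    and h_lim: "\<And>F x. F \<in> \<S> \<Longrightarrow> \<forall>\<^sub>F n in U. insert n F \<in> \<S> \<Longrightarrow> ((\<lambda>n. h (insert n F) x) \<longlongrightarrow> h F x) U"
    and M: "finite M" and inv: "\<And>F n. F \<subseteq> M \<Longrightarrow> F \<in> \<S> \<Longrightarrow> n \<in> M \<Longrightarrow> interpolates_within \<epsilon> c \<rho> J F z n (h F)"
  shows "\<exists>n k. (\<forall>m\<in>M. m < n) \<and> (\<forall>F m. F \<subseteq> insert n M \<longrightarrow> F \<in> \<S> \<longrightarrow> m \<in> insert n M \<longrightarrow>
    interpolates_within \<epsilon> c \<rho> J F (z(n := w n k)) m (h F))"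
proof -
  have norm_s: "norm s = 1" if "s \<in> {1, J}" for s
    using \<rho> that by (auto simp: scalar_coordinates_def)
  have bot: "U \<noteq> bot" using U by (simp add: ultrafilter_def)
  have ev_gt: "\<forall>\<^sub>F n in U. \<forall>m\<in>M. m < n"
    using U(2) eventually_gt_at_top by (intro eventually_ball_finite[OF M]) (auto simp: le_filter_def)
  have ev_null: "\<forall>\<^sub>F n in U. \<forall>F\<in>Pow M \<inter> \<S>. \<forall>s\<in>{1, J}. \<bar>h F (smul s (v n))\<bar> < \<epsilon>"
  proof (intro eventually_ball_finite ballI)
    fix F s assume F: "F \<in> Pow M \<inter> \<S>" and s: "s \<in> {1, J}"
    have "(\<lambda>x. h F (smul s x)) \<in> dual_ball"
      using F by (intro dual_ball_smul h norm_s[OF s]) auto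
    from weak_limitD[OF v this] have "(\<lambda>n. h F (smul s (v n))) \<longlonglongrightarrow> 0"
      using linear_0[OF dual_ballD(1)[OF h]] F by simp
    then have "\<forall>\<^sub>F n in sequentially. \<bar>h F (smul s (v n))\<bar> < \<epsilon>"
      using tendstoD[OF _ \<epsilon>] by fastforce
    then show "\<forall>\<^sub>F n in U. \<bar>h F (smul s (v n))\<bar> < \<epsilon>"
      using U(2) by (simp add: le_filter_def)
  qed (use M in auto)
  have ev_lim: "\<forall>\<^sub>F n in U. \<forall>F\<in>Pow M \<inter> \<S>. insert n F \<in> \<S> \<longrightarrow>
      (\<forall>m\<in>M. interpolates_within \<epsilon> c \<rho> J F z m (h (insert n F)))"
  proof (intro eventually_ball_finite ballI)
    fix F assume F: "F \<in> Pow M \<inter> \<S>"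
    show "\<forall>\<^sub>F n in U. insert n F \<in> \<S> \<longrightarrow>
      (\<forall>m\<in>M. interpolates_within \<epsilon> c \<rho> J F z m (h (insert n F)))"
    proof (cases "\<forall>\<^sub>F n in U. insert n F \<in> \<S>")
      case True
      have "\<forall>\<^sub>F n in U. \<forall>m\<in>M. \<forall>s\<in>{1, J}.
          \<bar>h (insert n F) (smul s (z m)) - (if m \<in> F then c * \<rho> s else 0)\<bar> < \<epsilon>"
      proof (intro eventually_ball_finite ballI)
        fix m s assume m: "m \<in> M" and s: "s \<in> {1, J}"
        define d where "d = (if m \<in> F then c * \<rho> s else 0)"
        have "((\<lambda>n. \<bar>h (insert n F) (smul s (z m)) - d\<bar>) \<longlongrightarrow> \<bar>h F (smul s (z m)) - d\<bar>) U"
          using F by (intro tendsto_rabs tendsto_diff h_lim True tendsto_const) auto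
        moreover have "\<bar>h F (smul s (z m)) - d\<bar> < \<epsilon>"
          using inv[of F m] F m s unfolding interpolates_within_def d_def by blast
        ultimately show "\<forall>\<^sub>F n in U. \<bar>h (insert n F) (smul s (z m)) - (if m \<in> F then c * \<rho> s else 0)\<bar> < \<epsilon>"
          unfolding d_def by (rule order_tendstoD(2))
      qed (use M in auto)
      then show ?thesis
        by eventually_elim (simp add: interpolates_within_def)
    next
      case False
      then have "\<forall>\<^sub>F n in U. insert n F \<notin> \<S>" using U(1) by (auto simp: ultrafilter_def)
      then show ?thesis by eventually_elim simp
    qed
  qed (use M in auto)
  obtain n where n_gt: "\<forall>m\<in>M. m < n"
    and null: "\<forall>F\<in>Pow M \<inter> \<S>. \<forall>s\<in>{1, J}. \<bar>h F (smul s (v n))\<bar> < \<epsilon>"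
    and lim: "\<forall>F\<in>Pow M \<inter> \<S>. insert n F \<in> \<S> \<longrightarrow>
      (\<forall>m\<in>M. interpolates_within \<epsilon> c \<rho> J F z m (h (insert n F)))"
    using eventually_happens[OF eventually_conj[OF ev_gt eventually_conj[OF ev_null ev_lim]]] bot by blast
  have "\<forall>\<^sub>F k in sequentially. \<forall>F\<in>Pow (insert n M) \<inter> \<S>. \<forall>s\<in>{1, J}.
      \<bar>h F (smul s (w n k)) - (if n \<in> F then c * \<rho> s else 0)\<bar> < \<epsilon>"
  proof (intro eventually_ball_finite ballI)
    fix F s assume F: "F \<in> Pow (insert n M) \<inter> \<S>" and s: "s \<in> {1, J}"
    define d where "d = (if n \<in> F then c * \<rho> s else 0)"
    have "(\<lambda>x. h F (smul s x)) \<in> dual_ball"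
      using F by (intro dual_ball_smul h norm_s[OF s]) auto
    from weak_limitD[OF w[of n] this]
    have "(\<lambda>k. \<bar>h F (smul s (w n k)) - d\<bar>) \<longlonglongrightarrow> \<bar>h F (smul s (v n)) - d\<bar>"
      by (intro tendsto_rabs tendsto_diff tendsto_const)
    moreover have "\<bar>h F (smul s (v n)) - d\<bar> < \<epsilon>"
    proof (cases "n \<in> F")
      case True
      then show ?thesis using h_eq[of F n s] F \<epsilon> by (simp add: d_def)
    next
      case False
      then have "F \<in> Pow M \<inter> \<S>" using F by auto
      then show ?thesis using null s False by (auto simp: d_def)
    qed
    ultimately show "\<forall>\<^sub>F k in sequentially. \<bar>h F (smul s (w n k)) - (if n \<in> F then c * \<rho> s else 0)\<bar> < \<epsilon>"
      unfolding d_def by (rule order_tendstoD(2))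
  qed (use M in auto)
  then obtain k where k: "\<forall>F\<in>Pow (insert n M) \<inter> \<S>. \<forall>s\<in>{1, J}.
      \<bar>h F (smul s (w n k)) - (if n \<in> F then c * \<rho> s else 0)\<bar> < \<epsilon>"
    using eventually_happens trivial_limit_sequentially by blast
  have "interpolates_within \<epsilon> c \<rho> J F (z(n := w n k)) m (h F)"
    if F: "F \<subseteq> insert n M" "F \<in> \<S>" and m: "m \<in> insert n M" for F m
  proof (cases "m = n")
    case True
    then show ?thesis using k F by (simp add: interpolates_within_def)
  next
    case m_n: False
    then have mM: "m \<in> M" using m by simp
    show ?thesis
    proof (cases "n \<in> F")
      case True
      define F' where "F' = F - {n}"
      have F': "F = insert n F'" "F' \<subseteq> M" "F' \<in> \<S>"
        using True F down[of F F'] by (auto simp: F'_def)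
      then have "interpolates_within \<epsilon> c \<rho> J F' z m (h F)"
        using lim F(2) mM by blast
      then show ?thesis
        using m_n unfolding interpolates_within_def F'(1) by simp
    next
      case False
      then have "F \<subseteq> M" using F by auto
      then have "interpolates_within \<epsilon> c \<rho> J F z m (h F)"
        using F(2) mM by (rule inv)
      then show ?thesis using m_n by (simp add: interpolates_within_def)
    qed
  qed
  then show ?thesis using n_gt by blast
qed

text \<open>
  The functional for \<open>F\<close> must be nearly right on the whole infinite set \<open>M\<close>, including points chosen
  after \<open>F\<close>, while \<open>z n\<close> is chosen before the later elements of the sets \<open>F\<close> are known. Reconciling
  the two is the reason for working with a coherent tree of functionals.
\<close>

lemma diagonal_selection:
  fixes \<S> :: "nat set set" and v :: "nat \<Rightarrow> 'a"
  assumes \<rho>: "scalar_coordinates \<rho> J" and \<epsilon>: "0 < \<epsilon>" and c: "0 < c"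
    and v: "weak_limit v 0" and w: "\<And>n. weak_limit (w n) (v n)"
    and fin: "\<And>F. F \<in> \<S> \<Longrightarrow> finite F"
    and down: "\<And>F F'. F \<in> \<S> \<Longrightarrow> F' \<subseteq> F \<Longrightarrow> F' \<in> \<S>"
    and lower: "\<And>F a. F \<in> \<S> \<Longrightarrow> c * (\<Sum>n\<in>F. norm (a n)) \<le> norm (\<Sum>n\<in>F. smul (a n) (v n))"
  obtains M z where "infinite M" "\<forall>n\<in>M. z n \<in> range (w n)"
    "\<forall>F. F \<subseteq> M \<and> F \<in> \<S> \<longrightarrow> (\<exists>f\<in>dual_ball. \<forall>n\<in>M. interpolates_within \<epsilon> c \<rho> J F z n f)"
proof -
  obtain U :: "nat filter" where U: "ultrafilter U" "U \<le> sequentially"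
    using exists_ultrafilter_le[OF sequentially_bot] by blast
  obtain h where h: "\<And>F. F \<in> \<S> \<Longrightarrow> h F \<in> dual_ball"
    and h_eq: "\<And>F n \<mu>. F \<in> \<S> \<Longrightarrow> n \<in> F \<Longrightarrow> h F (smul \<mu> (v n)) = c * \<rho> \<mu>"
    and h_lim: "\<And>F x. F \<in> \<S> \<Longrightarrow> \<forall>\<^sub>F n in U. insert n F \<in> \<S> \<Longrightarrow> ((\<lambda>n. h (insert n F) x) \<longlongrightarrow> h F x) U"
    using functional_tree[OF \<rho> c v fin lower U] by metis
  define Inv where "Inv S \<longleftrightarrow> finite (fst S) \<and> (\<forall>n\<in>fst S. snd S n \<in> range (w n)) \<and>
      (\<forall>F n. F \<subseteq> fst S \<longrightarrow> F \<in> \<S> \<longrightarrow> n \<in> fst S \<longrightarrow> interpolates_within \<epsilon> c \<rho> J F (snd S) n (h F))"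
    for S :: "nat set \<times> (nat \<Rightarrow> 'a)"
  define Ext where "Ext S S' \<longleftrightarrow> (\<exists>n. n \<notin> fst S \<and> fst S' = insert n (fst S) \<and> (\<forall>m\<in>fst S. snd S' m = snd S m))"
    for S S' :: "nat set \<times> (nat \<Rightarrow> 'a)"
  have "\<exists>S. \<forall>i. Inv (S i) \<and> Ext (S i) (S (Suc i))"
  proof (rule dependent_nat_choice)
    show "\<exists>S. Inv S" by (rule exI[of _ "({}, \<lambda>_. 0)"]) (simp add: Inv_def)
  next
    fix S and i :: nat assume S: "Inv S"
    have "\<exists>n k. (\<forall>m\<in>fst S. m < n) \<and> (\<forall>F m. F \<subseteq> insert n (fst S) \<longrightarrow> F \<in> \<S> \<longrightarrow> m \<in> insert n (fst S) \<longrightarrow>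
        interpolates_within \<epsilon> c \<rho> J F ((snd S)(n := w n k)) m (h F))"
      using S by (intro diagonal_selection_step[OF \<rho> \<epsilon> v w down U h h_eq h_lim]) (auto simp: Inv_def)
    then obtain n k where nk: "\<forall>m\<in>fst S. m < n"
      "\<forall>F m. F \<subseteq> insert n (fst S) \<longrightarrow> F \<in> \<S> \<longrightarrow> m \<in> insert n (fst S) \<longrightarrow>
        interpolates_within \<epsilon> c \<rho> J F ((snd S)(n := w n k)) m (h F)" by blast
    show "\<exists>S'. Inv S' \<and> Ext S S'"
    proof (intro exI conjI)
      show "Inv (insert n (fst S), (snd S)(n := w n k))"
        using S nk by (auto simp: Inv_def)
      show "Ext S (insert n (fst S), (snd S)(n := w n k))"
        using nk(1) unfolding Ext_def by (intro exI[of _ n]) auto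
    qed
  qed
  then obtain S where S: "\<forall>i. Inv (S i) \<and> Ext (S i) (S (Suc i))" ..
  define Mi zi where "Mi i = fst (S i)" and "zi i = snd (S i)" for i
  have step: "Mi i \<subseteq> Mi (Suc i)" and z_step: "\<And>m. m \<in> Mi i \<Longrightarrow> zi (Suc i) m = zi i m"
    and new: "Mi (Suc i) \<noteq> Mi i" for i
  proof -
    have "Ext (S i) (S (Suc i))" using S by blast
    then obtain n where "n \<notin> fst (S i)" "fst (S (Suc i)) = insert n (fst (S i))"
      "\<forall>m\<in>fst (S i). snd (S (Suc i)) m = snd (S i) m" unfolding Ext_def by (elim exE conjE)
    then show "Mi i \<subseteq> Mi (Suc i)" "\<And>m. m \<in> Mi i \<Longrightarrow> zi (Suc i) m = zi i m" "Mi (Suc i) \<noteq> Mi i"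
      by (auto simp: Mi_def zi_def)
  qed
  have mono: "Mi i \<subseteq> Mi j" if "i \<le> j" for i j
    using step that by (rule lift_Suc_mono_le)
  have z_mono: "zi j m = zi i m" if "i \<le> j" "m \<in> Mi i" for i j m
    using that(1)
  proof (induction j rule: dec_induct)
    case (step j)
    then have "m \<in> Mi j" using mono that(2) by blast
    then show ?case using z_step step.IH by simp
  qed simp
  define M where "M = (\<Union>i. Mi i)"
  define z where "z m = zi (LEAST i. m \<in> Mi i) m" for m
  have z: "z m = zi i m" if "m \<in> Mi i" for m i
    using z_mono[OF Least_le[of "\<lambda>i. m \<in> Mi i", OF that] LeastI[of "\<lambda>i. m \<in> Mi i", OF that]]
    by (simp add: z_def)
  have bounded: "\<exists>i. F \<subseteq> Mi i" if "finite F" "F \<subseteq> M" for F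
    using that
  proof (induction F)
    case (insert m F)
    then obtain i j where "F \<subseteq> Mi i" "m \<in> Mi j" by (auto simp: M_def)
    then have "insert m F \<subseteq> Mi (max i j)" using mono[of i "max i j"] mono[of j "max i j"] by auto
    then show ?case ..
  qed simp
  have "infinite M"
  proof
    assume "finite M"
    then obtain i where "M \<subseteq> Mi i" using bounded by blast
    then have "Mi (Suc i) \<subseteq> Mi i" by (auto simp: M_def)
    then show False using step[of i] new[of i] by blast
  qed
  moreover have "\<forall>n\<in>M. z n \<in> range (w n)"
  proof
    fix n assume "n \<in> M"
    then obtain i where i: "n \<in> Mi i" by (auto simp: M_def)
    moreover have "Inv (S i)" using S by blast
    ultimately show "z n \<in> range (w n)" unfolding z[OF i] by (simp add: Inv_def Mi_def zi_def)
  qed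
  moreover have "\<exists>f\<in>dual_ball. \<forall>n\<in>M. interpolates_within \<epsilon> c \<rho> J F z n f" if F: "F \<subseteq> M \<and> F \<in> \<S>" for F
  proof (intro bexI[of _ "h F"] ballI)
    show "h F \<in> dual_ball" using F h by blast
    fix n assume n: "n \<in> M"
    have "finite (insert n F)" "insert n F \<subseteq> M" using fin F n by auto
    then obtain i where i: "insert n F \<subseteq> Mi i" using bounded by blast
    have "Inv (S i)" using S by blast
    then have "interpolates_within \<epsilon> c \<rho> J F (zi i) n (h F)"
      using i F unfolding Inv_def Mi_def zi_def by blast
    then show "interpolates_within \<epsilon> c \<rho> J F z n (h F)"
      using z[of n i] i by (simp add: interpolates_within_def)
  qed
  ultimately show ?thesis by (intro that[of M z]) blast+
qed

end


section \<open>Schreier families and spreading models\<close>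

lemma schreier_finite: "schreier L \<xi> E \<Longrightarrow> finite E"
  by (induction rule: schreier.induct) auto

lemma schreier_spreading:
  assumes "schreier L \<xi> E" and g: "strict_mono (g :: nat \<Rightarrow> nat)"
  shows "schreier L \<xi> (g ` E)"
  using assms(1)
proof (induction rule: schreier.induct)
  case zero_empty
  show ?case by (simp add: schreier.zero_empty)
next
  case (zero_singleton n)
  then have "1 \<le> g n" using seq_suble[OF g, of n] by linarith
  then show ?case by (simp add: schreier.zero_singleton)
next
  case (succ_empty \<xi>)
  show ?case by (simp add: schreier.succ_empty)
next
  case (succ_Union n E \<xi>)
  have "schreier L (osuc \<xi>) (\<Union>i\<in>{1..n}. g ` E i)"
  proof (rule schreier.succ_Union)
    show "1 \<le> n" by fact
    show "\<forall>i\<in>{1..n}. g ` E i \<noteq> {} \<and> schreier L \<xi> (g ` E i)" using succ_Union.IH by auto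
    show "\<forall>i\<in>{1..<n}. \<forall>k\<in>g ` E i. \<forall>m\<in>g ` E (Suc i). k < m"
      using succ_Union.hyps g by (auto simp: strict_mono_less)
    show "\<forall>m\<in>g ` E 1. n \<le> m"
      using succ_Union.hyps seq_suble[OF g] by (auto intro: order_trans)
  qed
  then show ?case by (simp add: image_UN)
next
  case (limit \<xi> n E)
  then show ?case
    using seq_suble[OF g] by (intro schreier.limit[of \<xi> n]) (auto intro: order_trans)
qed

text \<open>
  Spreading model constants are infima over a set of norms, and this guarantees that the set is nonempty.
\<close>

lemma schreier_one:
  assumes L: "ladder_system L"
  shows "schreier L \<xi> {1}"
proof (induction \<xi> rule: less_induct)
  case (less \<xi>)
  consider "\<xi> = 0" | \<eta> where "\<xi> = osuc \<eta>" | "is_limit \<xi>"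
    unfolding is_limit_def by blast
  then show ?case
  proof cases
    case 1
    then show ?thesis by (simp add: schreier.zero_singleton)
  next
    case 2
    have "schreier L \<eta> {1}"
      using less.IH[of \<eta>] less_osuc[of \<eta>] 2 by simp
    then have "schreier L (osuc \<eta>) (\<Union>i\<in>{1..1::nat}. {1})"
      by (intro schreier.succ_Union) auto
    then show ?thesis using 2 by simp
  next
    case 3
    then have "L \<xi> 1 < \<xi>" using L by (auto simp: ladder_system_def)
    then show ?thesis using 3 less.IH by (intro schreier.limit[of \<xi> 1]) auto
  qed
qed

context banach_space_over
begin

text \<open>
  The homogeneous form of the definition, obtained by normalising the coefficients.
\<close>

lemma ell1_spreading_model_iff:
  assumes L: "ladder_system L"
  shows "ell1_spreading_model smul L \<xi> x \<longleftrightarrow>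
    (\<exists>c>0. \<forall>E a. schreier L \<xi> E \<longrightarrow> c * (\<Sum>n\<in>E. norm (a n)) \<le> norm (\<Sum>n\<in>E. smul (a n) (x n)))"
proof -
  define N where "N = {norm (\<Sum>n\<in>E. smul (a n) (x n)) | E a. schreier L \<xi> E \<and> (\<Sum>n\<in>E. norm (a n)) = 1}"
  have def: "ell1_spreading_model smul L \<xi> x \<longleftrightarrow> 0 < Inf N"
    by (simp add: ell1_spreading_model_def N_def)
  have ne: "N \<noteq> {}"
    unfolding N_def using schreier_one[OF L, of \<xi>] by (auto intro!: exI[of _ "{1}"] exI[of _ "\<lambda>_. 1"])
  show ?thesis
  proof
    assume "ell1_spreading_model smul L \<xi> x"
    then have pos: "0 < Inf N" by (simp add: def)
    have "Inf N * (\<Sum>n\<in>E. norm (a n)) \<le> norm (\<Sum>n\<in>E. smul (a n) (x n))" if E: "schreier L \<xi> E" for E a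
    proof (cases "(\<Sum>n\<in>E. norm (a n)) = 0")
      case False
      define A where "A = (\<Sum>n\<in>E. norm (a n))"
      have A: "0 < A" using False sum_nonneg[of E "\<lambda>n. norm (a n)"] by (simp add: A_def less_le)
      define b where "b n = of_real (1 / A) * a n" for n
      have "(\<Sum>n\<in>E. norm (b n)) = (1 / A) * A"
        unfolding b_def A_def sum_distrib_left using A by (simp add: norm_mult A_def norm_divide del: of_real_divide)
      then have "norm (\<Sum>n\<in>E. smul (b n) (x n)) \<in> N"
        unfolding N_def using E A by auto
      then have "Inf N \<le> norm (\<Sum>n\<in>E. smul (b n) (x n))"
        by (rule cInf_lower) (rule bdd_belowI[of _ 0], auto simp: N_def)
      also have "(\<Sum>n\<in>E. smul (b n) (x n)) = (1 / A) *\<^sub>R (\<Sum>n\<in>E. smul (a n) (x n))"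
        unfolding b_def scaleR_sum_right by (simp only: smul_of_real[symmetric] scale_scale)
      finally show ?thesis using A unfolding A_def[symmetric] by (simp add: field_simps)
    qed simp
    then show "\<exists>c>0. \<forall>E a. schreier L \<xi> E \<longrightarrow>
        c * (\<Sum>n\<in>E. norm (a n)) \<le> norm (\<Sum>n\<in>E. smul (a n) (x n))"
      using pos by blast
  next
    assume "\<exists>c>0. \<forall>E a. schreier L \<xi> E \<longrightarrow>
        c * (\<Sum>n\<in>E. norm (a n)) \<le> norm (\<Sum>n\<in>E. smul (a n) (x n))"
    then obtain c where c: "0 < c" "\<forall>E a. schreier L \<xi> E \<longrightarrow>
        c * (\<Sum>n\<in>E. norm (a n)) \<le> norm (\<Sum>n\<in>E. smul (a n) (x n))" by blast
    have "c \<le> Inf N"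
    proof (rule cInf_greatest[OF ne])
      fix y assume "y \<in> N"
      then obtain E a where "schreier L \<xi> E" "(\<Sum>n\<in>E. norm (a n)) = 1"
        "y = norm (\<Sum>n\<in>E. smul (a n) (x n))" by (auto simp: N_def)
      then show "c \<le> y" using c(2)[rule_format, of E a] by simp
    qed
    then show "ell1_spreading_model smul L \<xi> x" using c(1) by (simp add: def)
  qed
qed

lemma interpolation_on_multiples:
  assumes \<rho>: "scalar_coordinates \<rho> J" and f: "f \<in> dual_ball"
    and int: "interpolates_within \<epsilon> c \<rho> J F y n f"
  shows "\<bar>f (smul b (y n)) - (if n \<in> F then c * \<rho> b else 0)\<bar> \<le> 2 * \<epsilon> * norm b"
proof -
  define d where "d = (if n \<in> F then c else 0)"
  have lin: "linear \<rho>" and \<rho>_le: "\<And>z. \<bar>\<rho> z\<bar> \<le> norm z" and \<rho>1: "\<rho> 1 = 1" and J: "norm J = 1"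
    using \<rho> by (auto simp: scalar_coordinates_def)
  have \<rho>_real: "\<rho> (of_real t * z) = t * \<rho> z" for t z
    using linear_scale[OF lin, of t z] by (simp add: scaleR_conv_of_real)
  have f_real: "f (smul (of_real t * z) x) = t * f (smul z x)" for t z x
    using linear_scale[OF dual_ballD(1)[OF f], of t "smul z x"] by (simp add: smul_of_real[symmetric])
  define g where "g z = f (smul z (y n)) - d * \<rho> z" for z
  have g_add: "g (z + z') = g z + g z'" for z z'
    by (simp add: g_def scale_left_distrib linear_add[OF dual_ballD(1)[OF f]] linear_add[OF lin] algebra_simps)
  have g_real: "g (of_real t * z) = t * g z" for t z
    by (simp add: g_def f_real \<rho>_real right_diff_distrib mult.left_commute)
  have g: "\<bar>g 1\<bar> < \<epsilon>" "\<bar>g J\<bar> < \<epsilon>"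
    using int by (auto simp: g_def d_def interpolates_within_def split: if_splits)
  have \<epsilon>: "0 < \<epsilon>" using g(1) by linarith
  have "\<exists>s t. b = of_real s * 1 + of_real t * J \<and> \<bar>s\<bar> \<le> norm b \<and> \<bar>t\<bar> \<le> norm b"
  proof -
    consider "b = of_real (\<rho> b)" | "b = of_real (\<rho> b) - of_real (\<rho> (J * b)) * J"
      using \<rho> unfolding scalar_coordinates_def by blast
    then show ?thesis
    proof cases
      case 1
      then show ?thesis using \<rho>_le[of b] by (intro exI[of _ "\<rho> b"] exI[of _ 0]) simp
    next
      case 2
      have "b = of_real (\<rho> b) * 1 + of_real (- \<rho> (J * b)) * J"
        using 2 by simp
      then show ?thesis
        using \<rho>_le[of b] \<rho>_le[of "J * b"] J
        by (intro exI[of _ "\<rho> b"] exI[of _ "- \<rho> (J * b)"]) (auto simp: norm_mult)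
    qed
  qed
  then obtain s t where b: "b = of_real s * 1 + of_real t * J" and st: "\<bar>s\<bar> \<le> norm b" "\<bar>t\<bar> \<le> norm b"
    by blast
  have "g b = s * g 1 + t * g J" by (subst b) (simp only: g_add g_real)
  then have "\<bar>g b\<bar> \<le> \<bar>s\<bar> * \<bar>g 1\<bar> + \<bar>t\<bar> * \<bar>g J\<bar>"
    by (metis abs_mult abs_triangle_ineq)
  also have "\<dots> \<le> norm b * \<epsilon> + norm b * \<epsilon>"
    using st g \<epsilon> by (intro add_mono mult_mono) auto
  finally show ?thesis by (simp add: g_def d_def split: if_splits)
qed

text \<open>
  For a scalar \<open>u\<close> of modulus one, choose \<open>F\<close> as the set of those \<open>n\<close> with \<open>\<rho> (u * a n) > 0\<close>. The functional
  for this \<open>F\<close> bounds the norm from below by \<open>c\<close> times the sum of the positive parts of \<open>\<rho> (u * a n)\<close>, up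
  to the error \<open>2 * \<epsilon> * (\<Sum>n\<in>E. norm (a n))\<close>. Adding this up for \<open>u = 1, -1, J, -J\<close> recovers \<open>\<Sum>n\<in>E. norm (a n)\<close>,
  whence the factor \<open>1 / 4\<close>.
\<close>

lemma ell1_lower_estimate:
  fixes y :: "nat \<Rightarrow> 'a"
  assumes \<rho>: "scalar_coordinates \<rho> J" and c: "0 < c" and E: "finite E"
    and int: "\<And>F. F \<subseteq> E \<Longrightarrow> \<exists>f\<in>dual_ball. \<forall>n\<in>E. interpolates_within \<epsilon> c \<rho> J F y n f"
  shows "(c / 4 - 2 * \<epsilon>) * (\<Sum>n\<in>E. norm (a n)) \<le> norm (\<Sum>n\<in>E. smul (a n) (y n))"
proof -
  define A where "A = (\<Sum>n\<in>E. norm (a n))"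
  have lin: "linear \<rho>" and J: "norm J = 1"
    and norm_le: "\<And>z. norm z \<le> \<bar>\<rho> z\<bar> + \<bar>\<rho> (J * z)\<bar>"
    using \<rho> by (auto simp: scalar_coordinates_def)
  have est: "c * (\<Sum>n\<in>E. max 0 (\<rho> (u * a n))) - 2 * \<epsilon> * A \<le> norm (\<Sum>n\<in>E. smul (a n) (y n))"
    if u: "norm u = 1" for u
  proof -
    define b where "b n = u * a n" for n
    define F where "F = {n \<in> E. 0 < \<rho> (b n)}"
    obtain f where f: "f \<in> dual_ball" and fint: "\<forall>n\<in>E. interpolates_within \<epsilon> c \<rho> J F y n f"
      using int[of F] by (auto simp: F_def)
    have "c * max 0 (\<rho> (b n)) - 2 * \<epsilon> * norm (a n) \<le> f (smul (b n) (y n))" if n: "n \<in> E" for n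
    proof -
      have "\<bar>f (smul (b n) (y n)) - (if n \<in> F then c * \<rho> (b n) else 0)\<bar> \<le> 2 * \<epsilon> * norm (b n)"
        using fint n by (intro interpolation_on_multiples[OF \<rho> f]) auto
      moreover have "(if n \<in> F then c * \<rho> (b n) else 0) = c * max 0 (\<rho> (b n))"
        using n by (auto simp: F_def max_def)
      moreover have "norm (b n) = norm (a n)" using u by (simp add: b_def norm_mult)
      ultimately show ?thesis by (simp add: abs_le_iff)
    qed
    then have "(\<Sum>n\<in>E. c * max 0 (\<rho> (b n)) - 2 * \<epsilon> * norm (a n)) \<le> (\<Sum>n\<in>E. f (smul (b n) (y n)))"
      by (rule sum_mono)
    also have "\<dots> = f (\<Sum>n\<in>E. smul (b n) (y n))"
      by (rule linear_sum[OF dual_ballD(1)[OF f], symmetric])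
    also have "\<dots> \<le> norm (\<Sum>n\<in>E. smul (b n) (y n))" by (rule dual_ballD(3)[OF f])
    also have "(\<Sum>n\<in>E. smul (b n) (y n)) = smul u (\<Sum>n\<in>E. smul (a n) (y n))"
      by (simp add: b_def scale_sum_right)
    also have "norm \<dots> = norm (\<Sum>n\<in>E. smul (a n) (y n))" by (simp add: norm_smul u)
    finally show ?thesis
      by (simp add: sum_subtractf sum_distrib_left A_def b_def)
  qed
  have "norm z \<le> (max 0 (\<rho> z) + max 0 (\<rho> (- z))) + (max 0 (\<rho> (J * z)) + max 0 (\<rho> (- (J * z))))" for z
  proof -
    have "\<bar>t\<bar> = max 0 t + max 0 (- t)" for t :: real by (simp add: max_def abs_if)
    from norm_le[of z, unfolded this] show ?thesis by (simp add: linear_neg[OF lin])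
  qed
  then have "A \<le> (\<Sum>n\<in>E. (max 0 (\<rho> (1 * a n)) + max 0 (\<rho> (- 1 * a n))) +
      (max 0 (\<rho> (J * a n)) + max 0 (\<rho> (- J * a n))))"
    unfolding A_def by (intro sum_mono) simp
  then have "c * A \<le> c * ((\<Sum>n\<in>E. max 0 (\<rho> (1 * a n))) + (\<Sum>n\<in>E. max 0 (\<rho> (- 1 * a n))) +
      ((\<Sum>n\<in>E. max 0 (\<rho> (J * a n))) + (\<Sum>n\<in>E. max 0 (\<rho> (- J * a n)))))"
    using c by (simp only: sum.distrib mult_left_mono less_imp_le)
  then have "c * A \<le> 4 * (norm (\<Sum>n\<in>E. smul (a n) (y n)) + 2 * \<epsilon> * A)"
    using est[of 1] est[of "- 1"] est[of J] est[of "- J"] J by (simp add: distrib_left)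
  then show ?thesis by (simp add: A_def algebra_simps)
qed

text \<open>
  The functional attached to \<open>F\<close> is at most \<open>\<epsilon>\<close> at all points of the diagonal sequence outside \<open>F\<close>, hence
  also at every weak limit \<open>l\<close> of a subsequence. So subtracting \<open>l\<close> changes the interpolated values by at most
  \<open>\<epsilon>\<close>, which covers the case of a nonzero \<open>l\<close>.
\<close>

lemma diagonal_spreading_model:
  assumes L: "ladder_system L" and sm: "ell1_spreading_model smul L \<xi> v"
    and v: "weak_limit v 0" and w: "\<And>n. weak_limit (w n) (v n)"
  obtains m :: "nat \<Rightarrow> nat" and z where "strict_mono m" "\<forall>j. z j \<in> range (w (m j))"
    "\<forall>(r :: nat \<Rightarrow> nat) l. strict_mono r \<and> weak_limit (z \<circ> r) l \<longrightarrow> ell1_spreading_model smul L \<xi> (\<lambda>j. z (r j) - l)"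
proof -
  obtain \<rho> :: "'k \<Rightarrow> real" and J where \<rho>: "scalar_coordinates \<rho> J"
    using scalar_coordinates_exist by blast
  have norm_s: "norm s = 1" if "s \<in> {1, J}" for s
    using \<rho> that by (auto simp: scalar_coordinates_def)
  obtain c where c: "0 < c" and lower: "\<And>E a. schreier L \<xi> E \<Longrightarrow>
      c * (\<Sum>n\<in>E. norm (a n)) \<le> norm (\<Sum>n\<in>E. smul (a n) (v n))"
    using sm unfolding ell1_spreading_model_iff[OF L] by metis
  define \<S> where "\<S> = {F. \<exists>E. schreier L \<xi> E \<and> F \<subseteq> E}"
  \<comment> \<open>With interpolation error \<open>2 * \<epsilon>\<close> the lower estimate has the constant \<open>c / 4 - 4 * \<epsilon> = c / 8\<close>.\<close>
  define \<epsilon> where "\<epsilon> = c / 32"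
  have \<epsilon>: "0 < \<epsilon>" using c by (simp add: \<epsilon>_def)
  have fin: "finite F" if "F \<in> \<S>" for F
    using that unfolding \<S>_def by (blast intro: finite_subset schreier_finite)
  have down: "F' \<in> \<S>" if "F \<in> \<S>" "F' \<subseteq> F" for F F'
    using that by (auto simp: \<S>_def)
  have lower': "c * (\<Sum>n\<in>F. norm (a n)) \<le> norm (\<Sum>n\<in>F. smul (a n) (v n))" if F: "F \<in> \<S>" for F a
  proof -
    obtain E where E: "schreier L \<xi> E" "F \<subseteq> E" using F by (auto simp: \<S>_def)
    let ?a = "\<lambda>n. if n \<in> F then a n else 0"
    have "(\<Sum>n\<in>E. norm (?a n)) = (\<Sum>n\<in>F. norm (a n))"
      by (rule sum.mono_neutral_cong_right) (use E schreier_finite in auto)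
    moreover have "(\<Sum>n\<in>E. smul (?a n) (v n)) = (\<Sum>n\<in>F. smul (a n) (v n))"
      by (rule sum.mono_neutral_cong_right) (use E schreier_finite in auto)
    ultimately show ?thesis using lower[OF E(1), of ?a] by simp
  qed
  obtain M z where M: "infinite M" and z: "\<forall>n\<in>M. z n \<in> range (w n)"
    and int: "\<forall>F. F \<subseteq> M \<and> F \<in> \<S> \<longrightarrow> (\<exists>f\<in>dual_ball. \<forall>n\<in>M. interpolates_within \<epsilon> c \<rho> J F z n f)"
    by (rule diagonal_selection[OF \<rho> \<epsilon> c v w fin down lower'])
  define m where "m = enumerate M"
  have m: "strict_mono m" using M by (simp add: m_def strict_mono_enumerate)
  have mM: "m j \<in> M" for j using M by (simp add: m_def enumerate_in_set)
  show ?thesis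
  proof (rule that[of m "z \<circ> m"])
    show "strict_mono m" by (rule m)
    show "\<forall>j. (z \<circ> m) j \<in> range (w (m j))" using z mM by simp
    show "\<forall>(r :: nat \<Rightarrow> nat) l. strict_mono r \<and> weak_limit (z \<circ> m \<circ> r) l \<longrightarrow>
        ell1_spreading_model smul L \<xi> (\<lambda>j. (z \<circ> m) (r j) - l)"
    proof (intro allI impI, elim conjE)
      fix r :: "nat \<Rightarrow> nat" and l assume r: "strict_mono r" and l: "weak_limit (z \<circ> m \<circ> r) l"
      define g where "g j = m (r j)" for j
      have g: "strict_mono g" using m r by (simp add: g_def strict_mono_def)
      have gM: "g j \<in> M" for j by (simp add: g_def mM)
      let ?y = "\<lambda>j. (z \<circ> m) (r j) - l"
      have "c / 8 * (\<Sum>n\<in>E. norm (a n)) \<le> norm (\<Sum>n\<in>E. smul (a n) (?y n))"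
        if E: "schreier L \<xi> E" for E a
      proof -
        have "(c / 4 - 2 * (2 * \<epsilon>)) * (\<Sum>n\<in>E. norm (a n)) \<le> norm (\<Sum>n\<in>E. smul (a n) (?y n))"
        proof (rule ell1_lower_estimate[OF \<rho> c schreier_finite[OF E]])
          fix F assume F: "F \<subseteq> E"
          have gF: "g ` F \<in> \<S>"
            unfolding \<S>_def using schreier_spreading[OF E g] F by blast
          moreover have "g ` F \<subseteq> M" using gM by blast
          ultimately obtain f where f: "f \<in> dual_ball"
            and fz: "\<forall>n\<in>M. interpolates_within \<epsilon> c \<rho> J (g ` F) z n f"
            using int by blast
          have fl: "\<bar>f (smul s l)\<bar> \<le> \<epsilon>" if s: "s \<in> {1, J}" for s
          proof (rule tendsto_upperbound[OF tendsto_rabs])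
            show "(\<lambda>j. f (smul s ((z \<circ> m \<circ> r) j))) \<longlonglongrightarrow> f (smul s l)"
              by (rule weak_limitD[OF l dual_ball_smul[OF f norm_s[OF s]]])
            show "\<forall>\<^sub>F j in sequentially. \<bar>f (smul s ((z \<circ> m \<circ> r) j))\<bar> \<le> \<epsilon>"
              using eventually_gt_at_top[of "Max (insert 0 (g ` F))"]
            proof eventually_elim
              case (elim j)
              have "g j \<notin> g ` F"
              proof
                assume "g j \<in> g ` F"
                then have "g j \<le> Max (insert 0 (g ` F))" using fin[OF gF] by (intro Max_ge) auto
                then show False using elim seq_suble[OF g, of j] by linarith
              qed
              then show ?case
                using fz gM[of j] s unfolding interpolates_within_def by (auto simp: g_def less_imp_le)
            qed
          qed simp
          show "\<exists>f\<in>dual_ball. \<forall>n\<in>E. interpolates_within (2 * \<epsilon>) c \<rho> J F ?y n f"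
          proof (intro bexI[OF _ f] ballI)
            fix n assume "n \<in> E"
            show "interpolates_within (2 * \<epsilon>) c \<rho> J F ?y n f"
              unfolding interpolates_within_def
            proof
              fix s assume s: "s \<in> {1, J}"
              have "\<bar>f (smul s (z (g n))) - (if g n \<in> g ` F then c * \<rho> s else 0)\<bar> < \<epsilon>"
                using fz gM[of n] s unfolding interpolates_within_def by blast
              moreover have "g n \<in> g ` F \<longleftrightarrow> n \<in> F"
                using strict_mono_eq[OF g] by auto
              moreover have "f (smul s (?y n)) = f (smul s (z (g n))) - f (smul s l)"
                by (simp add: g_def scale_right_diff_distrib linear_diff[OF dual_ballD(1)[OF f]])
              ultimately show "\<bar>f (smul s (?y n)) - (if n \<in> F then c * \<rho> s else 0)\<bar> < 2 * \<epsilon>"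
                using fl[OF s] by (simp only:)
            qed
          qed
        qed
        then show ?thesis by (simp add: \<epsilon>_def field_simps)
      qed
      then show "ell1_spreading_model smul L \<xi> ?y"
        unfolding ell1_spreading_model_iff[OF L] using c by (intro exI[of _ "c / 8"]) simp
    qed
  qed
qed

section \<open>Convergence of order \<open>\<xi>\<close>\<close>

lemma weak_convergence_mode_ord:
  assumes L: "ladder_system L"
  shows "weak_convergence_mode (ord_weakly_convergent_to smul L \<xi>)"
proof
  fix x :: "nat \<Rightarrow> 'a" and l :: 'a and r :: "nat \<Rightarrow> nat"
  assume x: "ord_weakly_convergent_to smul L \<xi> x l"
  show "weak_limit x l"
    using x norm_limit_imp_weak_limit
    by (auto simp: ord_weakly_convergent_to_def weakly_convergent_to_iff split: if_splits)
  assume r: "strict_mono r"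
  have "\<nexists>s. strict_mono s \<and> ell1_spreading_model smul L \<xi> (\<lambda>n. (x \<circ> r) (s n) - l)" if "\<xi> \<noteq> 0"
  proof
    assume "\<exists>s. strict_mono s \<and> ell1_spreading_model smul L \<xi> (\<lambda>n. (x \<circ> r) (s n) - l)"
    then obtain s where s: "strict_mono s" and sm: "ell1_spreading_model smul L \<xi> (\<lambda>n. x ((r \<circ> s) n) - l)"
      by auto
    show False
      using x that strict_mono_o[OF r s] sm unfolding ord_weakly_convergent_to_def by metis
  qed
  then show "ord_weakly_convergent_to smul L \<xi> (x \<circ> r) l"
    using x LIMSEQ_subseq_LIMSEQ[OF _ r] weak_limit_subseq[OF _ r]
    by (auto simp: ord_weakly_convergent_to_def weakly_convergent_to_iff split: if_splits)
next
  fix l :: 'a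
  have "\<not> ell1_spreading_model smul L \<xi> (\<lambda>n. l - l)"
  proof
    assume "ell1_spreading_model smul L \<xi> (\<lambda>n. l - l)"
    then obtain c where "0 < c" "\<forall>E (a :: nat \<Rightarrow> 'k). schreier L \<xi> E \<longrightarrow>
        c * (\<Sum>n\<in>E. norm (a n)) \<le> norm (\<Sum>n\<in>E. smul (a n) (l - l))"
      unfolding ell1_spreading_model_iff[OF L] by blast
    then show False
      using schreier_one[OF L, of \<xi>] by (auto dest!: spec[of _ "{1}"] spec[of _ "\<lambda>_. 1"])
  qed
  then show "ord_weakly_convergent_to smul L \<xi> (\<lambda>_. l) l"
    by (simp add: ord_weakly_convergent_to_def weakly_convergent_to_iff weak_limit_def)
qed

text \<open>
  If \<open>y\<close> itself did not converge to \<open>l\<close> in the order \<open>\<xi>\<close>, a subsequence of \<open>y n - l\<close> would be a spreading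
  model. A diagonal sequence in the precompact set then has all its subsequences, shifted by their
  weak limits, as spreading models, which contradicts precompactness. For \<open>\<xi> = 0\<close> a diagonal sequence
  that is norm-asymptotic to \<open>y\<close> suffices.
\<close>

lemma diagonal_convergence_mode_ord:
  assumes L: "ladder_system L"
  shows "diagonal_convergence_mode (ord_weakly_convergent_to smul L \<xi>)"
proof -
  let ?conv = "ord_weakly_convergent_to smul L \<xi>"
  interpret weak_convergence_mode ?conv by (rule weak_convergence_mode_ord[OF L])
  show ?thesis
  proof
    fix K x y and l :: 'a
    assume K: "seq_precompact_for K" and xK: "\<And>n k. x n k \<in> K"
      and x: "\<And>n. ?conv (x n) (y n)" and y: "weak_limit y l"
    show "\<exists>r. strict_mono r \<and> ?conv (y \<circ> r) l"
    proof (cases "\<xi> = 0")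
      case True
      then have lim: "\<And>n. x n \<longlonglongrightarrow> y n" using x by (simp add: ord_weakly_convergent_to_def)
      have "\<forall>n. \<exists>k. dist (x n k) (y n) < 1 / real (Suc n)"
      proof
        fix n
        have "\<forall>\<^sub>F k in sequentially. dist (x n k) (y n) < 1 / real (Suc n)"
          by (rule tendstoD[OF lim]) simp
        then show "\<exists>k. dist (x n k) (y n) < 1 / real (Suc n)"
          using eventually_happens trivial_limit_sequentially by blast
      qed
      from choice[OF this] obtain \<kappa> where \<kappa>: "\<forall>n. dist (x n (\<kappa> n)) (y n) < 1 / real (Suc n)" ..
      have diff: "(\<lambda>n. x n (\<kappa> n) - y n) \<longlonglongrightarrow> 0"
      proof (rule Lim_null_comparison[OF _ LIMSEQ_inverse_real_of_nat[unfolded inverse_eq_divide]])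
        show "\<forall>\<^sub>F n in sequentially. norm (x n (\<kappa> n) - y n) \<le> 1 / real (Suc n)"
          using \<kappa> by (intro always_eventually allI) (simp add: dist_norm less_imp_le)
      qed
      have "range (\<lambda>n. x n (\<kappa> n)) \<subseteq> K" using xK by auto
      then obtain l' r where r: "strict_mono r" "?conv ((\<lambda>n. x n (\<kappa> n)) \<circ> r) l'"
        using K unfolding seq_precompact_for_def by blast
      then have "(\<lambda>n. x (r n) (\<kappa> (r n))) \<longlonglongrightarrow> l'"
        using True by (simp add: ord_weakly_convergent_to_def o_def)
      from tendsto_diff[OF this tendsto_subseq[OF diff r(1)]]
      have lim': "(y \<circ> r) \<longlonglongrightarrow> l'" by (simp add: o_def)
      then have "l' = l"
        using weak_limit_unique[OF norm_limit_imp_weak_limit weak_limit_subseq[OF y r(1)]] by blast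
      then show ?thesis
        using lim' r(1) True by (auto simp: ord_weakly_convergent_to_def)
    next
      case False
      show ?thesis
      proof (rule ccontr)
        assume "\<not> ?thesis"
        then have "\<not> ?conv (y \<circ> id) l" using strict_mono_id by blast
        then obtain r where r: "strict_mono r" and sm: "ell1_spreading_model smul L \<xi> (\<lambda>n. y (r n) - l)"
          using y False by (auto simp: ord_weakly_convergent_to_def weakly_convergent_to_iff)
        have v: "weak_limit (\<lambda>n. y (r n) - l) 0"
          using weak_limit_diff_const[OF weak_limit_subseq[OF y r], of l] by simp
        have w: "weak_limit (\<lambda>k. x (r n) k - l) (y (r n) - l)" for n
          by (rule weak_limit_diff_const[OF conv_weak_limit[OF x]])
        obtain m :: "nat \<Rightarrow> nat" and z where "strict_mono m" and z: "\<forall>j. z j \<in> range (\<lambda>k. x (r (m j)) k - l)"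
          and z_sm: "\<forall>(s :: nat \<Rightarrow> nat) l. strict_mono s \<and> weak_limit (z \<circ> s) l \<longrightarrow>
            ell1_spreading_model smul L \<xi> (\<lambda>j. z (s j) - l)"
          by (rule diagonal_spreading_model[OF L sm v w])
        have "range (\<lambda>j. z j + l) \<subseteq> K"
        proof (rule image_subsetI)
          fix j
          from z obtain k where "z j = x (r (m j)) k - l" by blast
          then show "z j + l \<in> K" using xK by simp
        qed
        then obtain l' s where s: "strict_mono s" and conv: "?conv ((\<lambda>j. z j + l) \<circ> s) l'"
          using K unfolding seq_precompact_for_def by blast
        have "weak_limit (z \<circ> s) (l' - l)"
          using weak_limit_diff_const[OF conv_weak_limit[OF conv], of l] by (simp add: o_def)
        then have "ell1_spreading_model smul L \<xi> (\<lambda>j. z (s j) - (l' - l))" using z_sm s by blast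
        then have "ell1_spreading_model smul L \<xi> (\<lambda>j. ((\<lambda>j. z j + l) \<circ> s) (id j) - l')"
          by (simp add: algebra_simps)
        then show False
          using conv False strict_mono_id unfolding ord_weakly_convergent_to_def by metis
      qed
    qed
  qed
qed

end

text \<open>
  Discarding the term at \<open>0\<close> turns a sequence indexed from \<open>1\<close> into one indexed from \<open>0\<close>.
\<close>

lemma sequences_from_one_iff:
  fixes K :: "'b set" and Q :: "(nat \<Rightarrow> 'b) \<Rightarrow> bool"
  assumes tail: "\<And>x. Q (\<lambda>n. x (Suc n)) \<Longrightarrow> Q x"
  shows "(\<forall>x. (\<forall>n\<ge>1. x n \<in> K) \<longrightarrow> Q x) \<longleftrightarrow> (\<forall>x. range x \<subseteq> K \<longrightarrow> Q x)"
  using tail by (auto simp: image_subset_iff)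

theorem theorem1p5:
  fixes smul :: "'k::real_or_complex \<Rightarrow> 'a::banach \<Rightarrow> 'a"
    and L :: "omega1 \<Rightarrow> nat \<Rightarrow> omega1"
    and \<xi> :: omega1
  assumes "banach_space_over smul"
    and "ladder_system L"
  shows "\<exists>\<tau> :: 'a topology.
    topspace \<tau> = UNIV \<and>
    (\<forall>K. ord_weakly_compact smul L \<xi> K \<longleftrightarrow> compactin \<tau> K) \<and>
    (\<forall>K. ord_weakly_precompact smul L \<xi> K \<longleftrightarrow> compactin \<tau> (\<tau> closure_of K))"
proof -
  interpret banach_space_over smul by fact
  interpret diagonal_convergence_mode "ord_weakly_convergent_to smul L \<xi>"
    by (rule diagonal_convergence_mode_ord[OF assms(2)])
  have shift: "\<exists>r. strict_mono r \<and> ord_weakly_convergent_to smul L \<xi> (x \<circ> r) l"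
    if "\<exists>r. strict_mono r \<and> ord_weakly_convergent_to smul L \<xi> ((\<lambda>n. x (Suc n)) \<circ> r) l" for x l
  proof -
    from that obtain r where "strict_mono r" "ord_weakly_convergent_to smul L \<xi> (x \<circ> (Suc \<circ> r)) l"
      by (auto simp: o_def)
    moreover have "strict_mono (Suc \<circ> r)" using \<open>strict_mono r\<close> by (simp add: strict_mono_def)
    ultimately show ?thesis by blast
  qed
  have compact: "ord_weakly_compact smul L \<xi> K \<longleftrightarrow> seq_compact_for K" for K
    unfolding ord_weakly_compact_def seq_compact_for_def
    by (rule sequences_from_one_iff) (use shift in blast)
  have precompact: "ord_weakly_precompact smul L \<xi> K \<longleftrightarrow> seq_precompact_for K" for K
    unfolding ord_weakly_precompact_def seq_precompact_for_def
    by (rule sequences_from_one_iff) (use shift in blast)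
  show ?thesis
    unfolding compact precompact compactin_closure_of_iff compactin_seq_topology_iff[symmetric]
    by (rule exI[of _ seq_topology]) (simp add: compactin_closure_of_iff)
qed

end
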